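(* Let $n\ge 1$. The assignment $\phi(e_0)=E_n$, $\phi(e_i)=E_{n-i}E_{n+i}$ for $1\le i\le n-1$ defines an isomorphism of $\mathbb{Z}[\delta^{\pm1}]$-algebras $\phi:\mathrm{DTL}(\mathrm{C}_n)\to \mathrm{STL}(\mathrm{A}_{2n-1})$.
   Context: All algebras are associative and unital over $\mathbb{Z}[\delta^{\pm 1}]$, where $\delta$ is an invertible indeterminate. $\mathrm{DTL}(\mathrm{C}_n)$ (the Dieck-Temperley-Lieb algebra of type $\mathrm{C}_n$) is the $\mathbb{Z}[\delta^{\pm1}]$-algebra generated by $e_0,e_1,\dots,e_{n-1}$ subject to: $e_0^2=\delta e_0$; $e_i^2=\delta^2 e_i$ for $1\le i\le n-1$; $e_ie_j=e_je_i$ if $|i-j|>1$; $e_ie_je_i=e_i$ if $i,j\ge 1$ and $|i-j|=1$; and $e_1e_0e_1=\delta e_1$. $\mathrm{TL}(\mathrm{A}_{m})$ (the Temperley-Lieb algebra) is the $\mathbb{Z}[\delta^{\pm1}]$-algebra generated by $E_1,\dots,E_m$ subject to $E_i^2=\delta E_i$; $E_iE_j=E_jE_i$ if $|i-j|>1$; $E_iE_jE_i=E_i$ if $|i-j|=1$. $\mathrm{TLM}(\mathrm{A}_m)$ is the multiplicative submonoid of $\mathrm{TL}(\mathrm{A}_m)$ generated by $\delta,\delta^{-1},E_1,\dots,E_m$. Let $\sigma$ be the automorphism of $\mathrm{TL}(\mathrm{A}_{2n-1})$ induced by the diagram automorphism, $\sigma(E_i)=E_{2n-i}$. It preserves $\mathrm{TLM}(\mathrm{A}_{2n-1})$.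 $\mathrm{STL}(\mathrm{A}_{2n-1})$ is the $\mathbb{Z}[\delta^{\pm1}]$-subalgebra of $\mathrm{TL}(\mathrm{A}_{2n-1})$ generated by the submonoid of $\sigma$-invariant elements of $\mathrm{TLM}(\mathrm{A}_{2n-1})$. *)

theory Defs
  imports
    "HOL-Library.Poly_Mapping"
    "HOL-Library.FuncSet"
    "HOL-Algebra.Module"
    "HOL-Algebra.QuotRing"
    "HOL-Algebra.Subrings"
begin

section \<open>Laurent polynomials and free algebras\<close>

text \<open>The product of \<^typ>\<open>int \<Rightarrow>\<^sub>0 int\<close> is convolution over the additive group of exponents,
  so this type is the ring of integral Laurent polynomials in one indeterminate.\<close>

type_synonym laurent = "int \<Rightarrow>\<^sub>0 int"

definition delta :: laurent
  where "delta = Poly_Mapping.single 1 1"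

definition delta_inv :: laurent
  where "delta_inv = Poly_Mapping.single (- 1) 1"

text \<open>Lists become the free monoid, written additively, so that the convolution product of
  \<^typ>\<open>nat list \<Rightarrow>\<^sub>0 laurent\<close> is that of the free algebra on generators indexed by \<^typ>\<open>nat\<close>.\<close>

instantiation list :: (type) monoid_add
begin

definition zero_list :: "'a list"
  where "zero_list = []"

definition plus_list :: "'a list \<Rightarrow> 'a list \<Rightarrow> 'a list"
  where "plus_list u v = u @ v"

instance
  by standard (simp_all add: zero_list_def plus_list_def)

end

type_synonym free = "nat list \<Rightarrow>\<^sub>0 laurent"

definition gen :: "nat \<Rightarrow> free"
  where "gen i = Poly_Mapping.single [i] 1"

definition scal :: "laurent \<Rightarrow> free \<Rightarrow> free"
  where "scal c f = Poly_Mapping.single [] c * f"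

definition free_alg :: "nat set \<Rightarrow> (laurent, free) module"
  where "free_alg X =
    \<lparr>carrier = {f. \<forall>w \<in> Poly_Mapping.keys f. set w \<subseteq> X},
     mult = (*), one = 1, zero = 0, add = (+), smult = scal\<rparr>"

section \<open>Algebras over the Laurent polynomials\<close>

text \<open>The locale \<^locale>\<open>algebra\<close> only covers commutative algebras. The notions needed
  here are therefore spelled out, with \<^typ>\<open>laurent\<close> itself (rather than a carrier inside it)
  as the ring of scalars.\<close>

definition alg_hom ::
    "('c, 'a, 'm) module_scheme \<Rightarrow> ('c, 'b, 'n) module_scheme \<Rightarrow> ('a \<Rightarrow> 'b) set"
  where "alg_hom A B =
    {h \<in> ring_hom A B. \<forall>c. \<forall>x \<in> carrier A. h (c \<odot>\<^bsub>A\<^esub> x) = c \<odot>\<^bsub>B\<^esub> h x}"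

definition alg_iso ::
    "('c, 'a, 'm) module_scheme \<Rightarrow> ('c, 'b, 'n) module_scheme \<Rightarrow> ('a \<Rightarrow> 'b) set"
  where "alg_iso A B = {h \<in> alg_hom A B. bij_betw h (carrier A) (carrier B)}"

definition subalg :: "'a set \<Rightarrow> ('c, 'a, 'm) module_scheme \<Rightarrow> bool"
  where "subalg B A \<longleftrightarrow> subring B A \<and> (\<forall>c. \<forall>x \<in> B. c \<odot>\<^bsub>A\<^esub> x \<in> B)"

definition quot_alg :: "('c, 'a, 'm) module_scheme \<Rightarrow> 'a set \<Rightarrow> ('c, 'a set) module"
  where "quot_alg A I =
    \<lparr>carrier = carrier (A Quot I), mult = mult (A Quot I), one = one (A Quot I),
     zero = zero (A Quot I), add = add (A Quot I),
     smult = (\<lambda>c X. \<Union>x \<in> X. I +>\<^bsub>A\<^esub> (c \<odot>\<^bsub>A\<^esub> x))\<rparr>"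

text \<open>A relation \<open>u = v\<close> is given as the element \<open>u - v\<close> of the free algebra. The ideals of
  \<^const>\<open>genideal\<close> are two-sided.\<close>

definition rel_ideal :: "nat set \<Rightarrow> free set \<Rightarrow> free set"
  where "rel_ideal X R = Idl\<^bsub>free_alg X\<^esub> R"

definition presented :: "nat set \<Rightarrow> free set \<Rightarrow> (laurent, free set) module"
  where "presented X R = quot_alg (free_alg X) (rel_ideal X R)"

definition presented_gen :: "nat set \<Rightarrow> free set \<Rightarrow> nat \<Rightarrow> free set"
  where "presented_gen X R i = rel_ideal X R +>\<^bsub>free_alg X\<^esub> gen i"

section \<open>The Dieck-Temperley-Lieb algebra of type C\<close>

definition dtl_rels :: "nat \<Rightarrow> free set"
  where "dtl_rels n =
    {gen 0 * gen 0 - scal delta (gen 0)} \<union>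
    {gen i * gen i - scal (delta ^ 2) (gen i) | i. 1 \<le> i \<and> i < n} \<union>
    {gen i * gen j - gen j * gen i | i j. i < n \<and> j < n \<and> \<bar>int i - int j\<bar> > 1} \<union>
    {gen i * gen j * gen i - gen i | i j.
       1 \<le> i \<and> i < n \<and> 1 \<le> j \<and> j < n \<and> \<bar>int i - int j\<bar> = 1} \<union>
    (if 2 \<le> n then {gen 1 * gen 0 * gen 1 - scal delta (gen 1)} else {})"

definition DTL :: "nat \<Rightarrow> (laurent, free set) module"
  where "DTL n = presented {..<n} (dtl_rels n)"

definition dtl_gen :: "nat \<Rightarrow> nat \<Rightarrow> free set"
  where "dtl_gen n i = presented_gen {..<n} (dtl_rels n) i"

section \<open>The Temperley-Lieb algebra of type A\<close>

definition tl_rels :: "nat \<Rightarrow> free set"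
  where "tl_rels m =
    {gen i * gen i - scal delta (gen i) | i. i \<in> {1..m}} \<union>
    {gen i * gen j - gen j * gen i | i j. i \<in> {1..m} \<and> j \<in> {1..m} \<and> \<bar>int i - int j\<bar> > 1} \<union>
    {gen i * gen j * gen i - gen i | i j. i \<in> {1..m} \<and> j \<in> {1..m} \<and> \<bar>int i - int j\<bar> = 1}"

definition TL :: "nat \<Rightarrow> (laurent, free set) module"
  where "TL m = presented {1..m} (tl_rels m)"

definition tl_gen :: "nat \<Rightarrow> nat \<Rightarrow> free set"
  where "tl_gen m i = presented_gen {1..m} (tl_rels m) i"

definition TLM :: "nat \<Rightarrow> free set set"
  where "TLM m = (\<lambda>M. submonoid M (TL m)) hull
    ({delta \<odot>\<^bsub>TL m\<^esub> \<one>\<^bsub>TL m\<^esub>, delta_inv \<odot>\<^bsub>TL m\<^esub> \<one>\<^bsub>TL m\<^esub>} \<union> tl_gen m ` {1..m})"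

section \<open>The diagram automorphism and the symmetric subalgebra\<close>

definition relabel :: "(nat \<Rightarrow> nat) \<Rightarrow> free \<Rightarrow> free"
  where "relabel r f =
    (\<Sum>w \<in> Poly_Mapping.keys f. Poly_Mapping.single (map r w) (Poly_Mapping.lookup f w))"

text \<open>Elements of \<^term>\<open>TL m\<close> are cosets of the relation ideal, and the relabelling
  \<open>i \<mapsto> 2 * n - i\<close> of \<open>{1..2 * n - 1}\<close> preserves that ideal; so the automorphism it induces is
  taking images of cosets (see \<open>sigma_alg_iso\<close> and \<open>sigma_tl_gen\<close> below).\<close>

definition sigma :: "nat \<Rightarrow> free set \<Rightarrow> free set"
  where "sigma n x = relabel (\<lambda>i. 2 * n - i) ` x"

definition STL :: "nat \<Rightarrow> (laurent, free set) module"
  where "STL n = TL (2 * n - 1)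
    \<lparr>carrier := (\<lambda>B. subalg B (TL (2 * n - 1))) hull {x \<in> TLM (2 * n - 1). sigma n x = x}\<rparr>"

definition phi_gen :: "nat \<Rightarrow> nat \<Rightarrow> free set"
  where "phi_gen n i =
    (if i = 0 then tl_gen (2 * n - 1) n
     else tl_gen (2 * n - 1) (n - i) \<otimes>\<^bsub>TL (2 * n - 1)\<^esub> tl_gen (2 * n - 1) (n + i))"

section \<open>Well-definedness\<close>

lemma free_alg_simps [simp]:
  "f \<in> carrier (free_alg X) \<longleftrightarrow> (\<forall>w \<in> Poly_Mapping.keys f. set w \<subseteq> X)"
  "mult (free_alg X) = (*)" "one (free_alg X) = 1" "zero (free_alg X) = 0"
  "add (free_alg X) = (+)" "smult (free_alg X) = scal"
  by (simp_all add: free_alg_def)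

lemma scal_closed: "f \<in> carrier (free_alg X) \<Longrightarrow> scal c f \<in> carrier (free_alg X)"
  using keys_mult[of "Poly_Mapping.single [] c" f]
  by (fastforce simp: scal_def plus_list_def split: if_splits)

lemma mult_closed:
  "f \<in> carrier (free_alg X) \<Longrightarrow> g \<in> carrier (free_alg X) \<Longrightarrow> f * g \<in> carrier (free_alg X)"
  using keys_mult[of f g] by (fastforce simp: plus_list_def)

lemma add_closed:
  "f \<in> carrier (free_alg X) \<Longrightarrow> g \<in> carrier (free_alg X) \<Longrightarrow> f + g \<in> carrier (free_alg X)"
  using keys_add[of f g] by fastforce

lemma diff_closed:
  "f \<in> carrier (free_alg X) \<Longrightarrow> g \<in> carrier (free_alg X) \<Longrightarrow> f - g \<in> carrier (free_alg X)"
  using keys_diff[of f g] by fastforce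

lemma one_closed: "1 \<in> carrier (free_alg X)"
  by (simp add: single_one[symmetric] zero_list_def del: single_one)

lemma gen_closed: "i \<in> X \<Longrightarrow> gen i \<in> carrier (free_alg X)"
  by (simp add: gen_def)

lemmas free_alg_closed = scal_closed mult_closed add_closed diff_closed one_closed gen_closed

lemma ring_free_alg: "ring (free_alg X)"
proof (rule ringI)
  show "abelian_group (free_alg X)"
  proof (rule abelian_groupI)
    fix f assume "f \<in> carrier (free_alg X)"
    then have "0 - f \<in> carrier (free_alg X)"
      by (intro diff_closed) simp_all
    moreover have "(0 - f) \<oplus>\<^bsub>free_alg X\<^esub> f = \<zero>\<^bsub>free_alg X\<^esub>"
      by simp
    ultimately show "\<exists>g \<in> carrier (free_alg X). g \<oplus>\<^bsub>free_alg X\<^esub> f = \<zero>\<^bsub>free_alg X\<^esub>" ..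
  next
    fix f g assume "f \<in> carrier (free_alg X)" "g \<in> carrier (free_alg X)"
    then show "f \<oplus>\<^bsub>free_alg X\<^esub> g \<in> carrier (free_alg X)"
      unfolding free_alg_simps(5) by (rule add_closed)
  next
    show "\<zero>\<^bsub>free_alg X\<^esub> \<in> carrier (free_alg X)"
      by simp
  next
    fix f g h :: free
    show "f \<oplus>\<^bsub>free_alg X\<^esub> g \<oplus>\<^bsub>free_alg X\<^esub> h = f \<oplus>\<^bsub>free_alg X\<^esub> (g \<oplus>\<^bsub>free_alg X\<^esub> h)"
      unfolding free_alg_simps by (rule add.assoc)
    show "f \<oplus>\<^bsub>free_alg X\<^esub> g = g \<oplus>\<^bsub>free_alg X\<^esub> f"
      unfolding free_alg_simps by (rule add.commute)
    show "\<zero>\<^bsub>free_alg X\<^esub> \<oplus>\<^bsub>free_alg X\<^esub> f = f"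
      unfolding free_alg_simps by (rule add_0)
  qed
  show "Group.monoid (free_alg X)"
  proof (rule monoidI)
    fix f g assume "f \<in> carrier (free_alg X)" "g \<in> carrier (free_alg X)"
    then show "f \<otimes>\<^bsub>free_alg X\<^esub> g \<in> carrier (free_alg X)"
      unfolding free_alg_simps(2) by (rule mult_closed)
  next
    show "\<one>\<^bsub>free_alg X\<^esub> \<in> carrier (free_alg X)"
      unfolding free_alg_simps(3) by (rule one_closed)
  next
    fix f g h :: free
    show "f \<otimes>\<^bsub>free_alg X\<^esub> g \<otimes>\<^bsub>free_alg X\<^esub> h = f \<otimes>\<^bsub>free_alg X\<^esub> (g \<otimes>\<^bsub>free_alg X\<^esub> h)"
      unfolding free_alg_simps by (rule mult.assoc)
    show "\<one>\<^bsub>free_alg X\<^esub> \<otimes>\<^bsub>free_alg X\<^esub> f = f" "f \<otimes>\<^bsub>free_alg X\<^esub> \<one>\<^bsub>free_alg X\<^esub> = f"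
      unfolding free_alg_simps by simp_all
  qed
next
  fix f g h :: free
  show "(f \<oplus>\<^bsub>free_alg X\<^esub> g) \<otimes>\<^bsub>free_alg X\<^esub> h =
      f \<otimes>\<^bsub>free_alg X\<^esub> h \<oplus>\<^bsub>free_alg X\<^esub> g \<otimes>\<^bsub>free_alg X\<^esub> h"
    unfolding free_alg_simps by (rule distrib_right)
  show "h \<otimes>\<^bsub>free_alg X\<^esub> (f \<oplus>\<^bsub>free_alg X\<^esub> g) =
      h \<otimes>\<^bsub>free_alg X\<^esub> f \<oplus>\<^bsub>free_alg X\<^esub> h \<otimes>\<^bsub>free_alg X\<^esub> g"
    unfolding free_alg_simps by (rule distrib_left)
qed

lemma tl_rels_closed: "tl_rels m \<subseteq> carrier (free_alg {1..m})"
  unfolding tl_rels_def by (auto simp del: free_alg_simps intro!: free_alg_closed)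

lemma dtl_rels_closed:
  assumes "n \<ge> 1"
  shows "dtl_rels n \<subseteq> carrier (free_alg {..<n})"
  using assms unfolding dtl_rels_def
  by (auto simp del: free_alg_simps intro!: free_alg_closed)

lemma ideal_rel_ideal:
  assumes "R \<subseteq> carrier (free_alg X)"
  shows "ideal (rel_ideal X R) (free_alg X)"
  unfolding rel_ideal_def using ring.genideal_ideal[OF ring_free_alg assms] .

lemma rel_ideal_scal:
  assumes "R \<subseteq> carrier (free_alg X)" "h \<in> rel_ideal X R"
  shows "scal c h \<in> rel_ideal X R"
  using ideal.I_l_closed[OF ideal_rel_ideal[OF assms(1)] assms(2), of "Poly_Mapping.single [] c"]
  by (simp add: scal_def)

lemma ideal_free_alg:
  assumes "ideal J (free_alg X)"
  shows "0 \<in> J"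
    and "f \<in> J \<Longrightarrow> g \<in> J \<Longrightarrow> f + g \<in> J"
    and "f \<in> J \<Longrightarrow> - f \<in> J"
proof -
  interpret J: ideal J "free_alg X" by (rule assms)
  show "0 \<in> J" "f \<in> J \<Longrightarrow> g \<in> J \<Longrightarrow> f + g \<in> J"
    using additive_subgroup.zero_closed[OF J.is_additive_subgroup]
      additive_subgroup.a_closed[OF J.is_additive_subgroup, of f g] by simp_all
  show "- f \<in> J" if "f \<in> J"
    using J.I_l_closed[OF that, of "- 1"] one_closed[of X] by simp
qed

lemma coset_free_alg: "I +>\<^bsub>free_alg X\<^esub> f = (\<lambda>h. h + f) ` I"
  by (auto simp: a_r_coset_def')

lemma coset_eqI:
  assumes "R \<subseteq> carrier (free_alg X)" and "f - g \<in> rel_ideal X R"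
  shows "rel_ideal X R +>\<^bsub>free_alg X\<^esub> f = rel_ideal X R +>\<^bsub>free_alg X\<^esub> g"
proof -
  note I = ideal_free_alg[OF ideal_rel_ideal[OF assms(1)]]
  have "h + f \<in> (\<lambda>h. h + g) ` rel_ideal X R" if "h \<in> rel_ideal X R" for h
    using I(2)[OF that assms(2)]
    by (intro image_eqI[of _ _ "h + (f - g)"]) (auto simp: algebra_simps)
  moreover have "h + g \<in> (\<lambda>h. h + f) ` rel_ideal X R" if "h \<in> rel_ideal X R" for h
    using I(2)[OF that I(3)[OF assms(2)]]
    by (intro image_eqI[of _ _ "h + - (f - g)"]) (auto simp: algebra_simps)
  ultimately show ?thesis
    by (auto simp: coset_free_alg)
qed

lemma presented_simps:
  assumes "R \<subseteq> carrier (free_alg X)"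
  defines "c \<equiv> \<lambda>f. rel_ideal X R +>\<^bsub>free_alg X\<^esub> f"
  shows "carrier (presented X R) = c ` carrier (free_alg X)"
    and "\<one>\<^bsub>presented X R\<^esub> = c 1"
    and "\<zero>\<^bsub>presented X R\<^esub> = c 0"
    and "f \<in> carrier (free_alg X) \<Longrightarrow> g \<in> carrier (free_alg X) \<Longrightarrow>
      c f \<otimes>\<^bsub>presented X R\<^esub> c g = c (f * g)"
    and "f \<in> carrier (free_alg X) \<Longrightarrow> g \<in> carrier (free_alg X) \<Longrightarrow>
      c f \<oplus>\<^bsub>presented X R\<^esub> c g = c (f + g)"
    and "a \<odot>\<^bsub>presented X R\<^esub> c f = c (scal a f)"
proof -
  interpret I: ideal "rel_ideal X R" "free_alg X"
    using ideal_rel_ideal[OF assms(1)] .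
  show "carrier (presented X R) = c ` carrier (free_alg X)"
    by (auto simp: presented_def quot_alg_def FactRing_def A_RCOSETS_def' c_def)
  show "\<one>\<^bsub>presented X R\<^esub> = c 1"
    by (simp add: presented_def quot_alg_def FactRing_def c_def)
  show "\<zero>\<^bsub>presented X R\<^esub> = c 0"
    by (simp add: presented_def quot_alg_def FactRing_def c_def coset_free_alg)
  show "c f \<otimes>\<^bsub>presented X R\<^esub> c g = c (f * g)"
    if "f \<in> carrier (free_alg X)" "g \<in> carrier (free_alg X)"
    using I.rcoset_mult_add[OF that] by (simp add: presented_def quot_alg_def FactRing_def c_def)
  show "c f \<oplus>\<^bsub>presented X R\<^esub> c g = c (f + g)"
    if "f \<in> carrier (free_alg X)" "g \<in> carrier (free_alg X)"
    using I.a_rcos_sum[OF that] by (simp add: presented_def quot_alg_def FactRing_def c_def)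
  have "c (scal a (h + f)) = c (scal a f)" if "h \<in> rel_ideal X R" for h
    unfolding c_def
    by (rule coset_eqI[OF assms(1)]) (use rel_ideal_scal[OF assms(1) that] in
        \<open>simp add: scal_def algebra_simps\<close>)
  moreover have "0 \<in> rel_ideal X R"
    by (rule ideal_free_alg(1)[OF ideal_rel_ideal[OF assms(1)]])
  moreover have "c f = (\<lambda>h. h + f) ` rel_ideal X R"
    by (simp add: c_def coset_free_alg)
  ultimately have "(\<Union>x \<in> c f. c (scal a x)) = c (scal a f)"
    by auto
  then show "a \<odot>\<^bsub>presented X R\<^esub> c f = c (scal a f)"
    by (simp add: presented_def quot_alg_def c_def)
qed

lemma ring_presented:
  assumes "R \<subseteq> carrier (free_alg X)"
  shows "ring (presented X R)"
proof -
  let ?Q = "free_alg X Quot rel_ideal X R"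
  interpret Q: ring ?Q
    using ideal.quotient_is_ring[OF ideal_rel_ideal[OF assms]] .
  have eq: "carrier (presented X R) = carrier ?Q" "mult (presented X R) = mult ?Q"
    "one (presented X R) = one ?Q" "zero (presented X R) = zero ?Q"
    "add (presented X R) = add ?Q"
    by (simp_all add: presented_def quot_alg_def)
  show ?thesis
  proof (rule ringI)
    show "abelian_group (presented X R)"
      by (rule abelian_groupI; unfold eq)
        (fact Q.a_closed Q.zero_closed Q.a_assoc Q.a_comm Q.l_zero
          | (rule Q.a_closed Q.zero_closed Q.a_assoc Q.a_comm Q.l_zero; assumption)
          | (rule bexI[rotated], erule Q.a_inv_closed, erule Q.l_neg))+
    show "Group.monoid (presented X R)"
      by (rule monoidI; unfold eq)
        (rule Q.m_closed Q.one_closed Q.m_assoc Q.l_one Q.r_one; assumption)+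
  qed (unfold eq, (rule Q.l_distr Q.r_distr; assumption)+)
qed

lemma ring_TL: "ring (TL m)"
  unfolding TL_def by (rule ring_presented[OF tl_rels_closed])

lemma ring_DTL: "n \<ge> 1 \<Longrightarrow> ring (DTL n)"
  unfolding DTL_def by (rule ring_presented[OF dtl_rels_closed])

lemma relabel_superset:
  assumes "finite S" "Poly_Mapping.keys f \<subseteq> S"
  shows "relabel r f =
    (\<Sum>w \<in> S. Poly_Mapping.single (map r w) (Poly_Mapping.lookup f w))"
  unfolding relabel_def
  by (rule sum.mono_neutral_left[OF assms]) (simp add: in_keys_iff)

lemma relabel_single: "relabel r (Poly_Mapping.single w c) = Poly_Mapping.single (map r w) c"
  by (cases "c = 0") (simp_all add: relabel_def)

lemma relabel_zero: "relabel r 0 = 0"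
  by (simp add: relabel_def)

lemma relabel_add: "relabel r (f + g) = relabel r f + relabel r g"
proof -
  let ?S = "Poly_Mapping.keys f \<union> Poly_Mapping.keys g"
  have "Poly_Mapping.keys (f + g) \<subseteq> ?S" by (rule keys_add)
  then show ?thesis
    by (simp add: relabel_superset[of ?S] lookup_add single_add sum.distrib)
qed

lemma relabel_sum: "relabel r (sum F A) = (\<Sum>a \<in> A. relabel r (F a))"
  by (induction A rule: infinite_finite_induct) (simp_all add: relabel_zero relabel_add)

lemma relabel_diff: "relabel r (f - g) = relabel r f - relabel r g"
  using relabel_add[of r "f - g" g] by (simp add: algebra_simps)

lemma free_expand:
  "(f :: free) = (\<Sum>w \<in> Poly_Mapping.keys f. Poly_Mapping.single w (Poly_Mapping.lookup f w))"
  by (rule poly_mapping_eqI)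
    (simp add: lookup_sum lookup_single when_def sum.delta in_keys_iff)

lemma relabel_mult: "relabel r (f * g) = relabel r f * relabel r g"
proof -
  let ?s = "\<lambda>f w. Poly_Mapping.single w (Poly_Mapping.lookup f w)"
  have "relabel r (f * g) =
      relabel r (\<Sum>u \<in> Poly_Mapping.keys f. \<Sum>v \<in> Poly_Mapping.keys g. ?s f u * ?s g v)"
    by (subst free_expand[of f], subst free_expand[of g]) (simp only: sum_product)
  also have "\<dots> = relabel r f * relabel r g"
    by (simp add: relabel_sum relabel_def[of r f] relabel_def[of r g] sum_product mult_single
        relabel_single plus_list_def)
  finally show ?thesis .
qed

lemma relabel_gen: "relabel r (gen i) = gen (r i)"
  by (simp add: gen_def relabel_single)

lemma relabel_one: "relabel r 1 = 1"
  by (simp add: single_one[symmetric] relabel_single zero_list_def del: single_one)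

lemma relabel_scal: "relabel r (scal c f) = scal c (relabel r f)"
  by (simp add: scal_def relabel_mult relabel_single)

lemma relabel_closed:
  assumes "f \<in> carrier (free_alg X)" "\<And>i. i \<in> X \<Longrightarrow> r i \<in> X"
  shows "relabel r f \<in> carrier (free_alg X)"
proof -
  have "w' \<in> map r ` Poly_Mapping.keys f" if "w' \<in> Poly_Mapping.keys (relabel r f)" for w'
  proof (rule ccontr)
    assume "w' \<notin> map r ` Poly_Mapping.keys f"
    then have "Poly_Mapping.lookup (relabel r f) w' = 0"
      by (auto simp: relabel_def lookup_sum lookup_single when_def intro!: sum.neutral)
    with that show False by (simp add: in_keys_iff)
  qed
  with assms show ?thesis by fastforce
qed

lemma relabel_involution:
  assumes "f \<in> carrier (free_alg X)" "\<And>i. i \<in> X \<Longrightarrow> r (r i) = i"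
  shows "relabel r (relabel r f) = f"
proof -
  have "relabel r (relabel r f) = (\<Sum>w \<in> Poly_Mapping.keys f.
      Poly_Mapping.single (map r (map r w)) (Poly_Mapping.lookup f w))"
    by (subst relabel_def[of r f]) (simp add: relabel_sum relabel_single)
  also have "\<dots> = (\<Sum>w \<in> Poly_Mapping.keys f. Poly_Mapping.single w (Poly_Mapping.lookup f w))"
  proof (rule sum.cong[OF refl])
    fix w assume "w \<in> Poly_Mapping.keys f"
    with assms have "map r (map r w) = w"
      by (simp, intro map_idI) auto
    then show "Poly_Mapping.single (map r (map r w)) (Poly_Mapping.lookup f w) =
        Poly_Mapping.single w (Poly_Mapping.lookup f w)" by simp
  qed
  finally show ?thesis using free_expand[of f] by simp
qed

context
  fixes n :: nat and I :: "free set" and X :: "nat set" and \<rho> :: "nat \<Rightarrow> nat"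
  defines "X \<equiv> {1..2 * n - 1}" and "I \<equiv> rel_ideal {1..2 * n - 1} (tl_rels (2 * n - 1))"
    and "\<rho> \<equiv> \<lambda>i. 2 * n - i"
begin

private lemma rho: "i \<in> X \<Longrightarrow> \<rho> i \<in> X" "i \<in> X \<Longrightarrow> \<rho> (\<rho> i) = i"
  by (auto simp: X_def \<rho>_def)

private lemma ideal_I: "ideal I (free_alg X)"
  unfolding I_def X_def by (rule ideal_rel_ideal[OF tl_rels_closed])

private lemma relabel_tl_rels:
  assumes "u \<in> tl_rels (2 * n - 1)"
  shows "relabel \<rho> u \<in> tl_rels (2 * n - 1)"
proof -
  have d: "\<bar>int (\<rho> i) - int (\<rho> j)\<bar> = \<bar>int i - int j\<bar>" if "i \<in> X" "j \<in> X" for i j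
    using that by (auto simp: X_def \<rho>_def)
  from assms consider
      i where "i \<in> X" "u = gen i * gen i - scal delta (gen i)"
    | i j where "i \<in> X" "j \<in> X" "\<bar>int i - int j\<bar> > 1" "u = gen i * gen j - gen j * gen i"
    | i j where "i \<in> X" "j \<in> X" "\<bar>int i - int j\<bar> = 1" "u = gen i * gen j * gen i - gen i"
    unfolding tl_rels_def X_def by blast
  then show ?thesis
  proof cases
    case (1 i)
    then have "relabel \<rho> u = gen (\<rho> i) * gen (\<rho> i) - scal delta (gen (\<rho> i))"
      by (simp add: relabel_diff relabel_mult relabel_scal relabel_gen)
    with 1 rho(1)[of i] show ?thesis
      unfolding tl_rels_def X_def by blast
  next
    case (2 i j)
    then have "relabel \<rho> u = gen (\<rho> i) * gen (\<rho> j) - gen (\<rho> j) * gen (\<rho> i)"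
      by (simp add: relabel_diff relabel_mult relabel_gen)
    moreover have "\<bar>int (\<rho> i) - int (\<rho> j)\<bar> > 1" "\<rho> i \<in> X" "\<rho> j \<in> X"
      using 2 d rho(1) by auto
    ultimately show ?thesis
      unfolding tl_rels_def X_def by blast
  next
    case (3 i j)
    then have "relabel \<rho> u = gen (\<rho> i) * gen (\<rho> j) * gen (\<rho> i) - gen (\<rho> i)"
      by (simp add: relabel_diff relabel_mult relabel_gen)
    moreover have "\<bar>int (\<rho> i) - int (\<rho> j)\<bar> = 1" "\<rho> i \<in> X" "\<rho> j \<in> X"
      using 3 d rho(1) by auto
    ultimately show ?thesis
      unfolding tl_rels_def X_def by blast
  qed
qed

private lemma relabel_I_sub:
  assumes "f \<in> I"
  shows "relabel \<rho> f \<in> I"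
proof -
  interpret I: ideal I "free_alg X" by (rule ideal_I)
  let ?J = "{f \<in> carrier (free_alg X). relabel \<rho> f \<in> I}"
  have cl: "relabel \<rho> g \<in> carrier (free_alg X)" if "g \<in> carrier (free_alg X)" for g
    using relabel_closed[OF that rho(1)] .
  have J: "ideal ?J (free_alg X)"
  proof (rule idealI[OF ring_free_alg])
    show "subgroup ?J (add_monoid (free_alg X))"
    proof
      show "?J \<subseteq> carrier (add_monoid (free_alg X))" by auto
      show "\<one>\<^bsub>add_monoid (free_alg X)\<^esub> \<in> ?J"
        using ideal_free_alg(1)[OF ideal_I] by (simp add: relabel_zero)
      show "x \<otimes>\<^bsub>add_monoid (free_alg X)\<^esub> y \<in> ?J" if "x \<in> ?J" "y \<in> ?J" for x y
        using that ideal_free_alg(2)[OF ideal_I, of "relabel \<rho> x" "relabel \<rho> y"]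
          add_closed[of x X y]
        by (simp add: relabel_add)
      show "inv\<^bsub>add_monoid (free_alg X)\<^esub> x \<in> ?J" if "x \<in> ?J" for x
      proof -
        have x: "x \<in> carrier (free_alg X)" "relabel \<rho> x \<in> I" using that by auto
        have "\<ominus>\<^bsub>free_alg X\<^esub> x + x = 0"
          using I.l_neg[OF x(1)] by simp
        then have "inv\<^bsub>add_monoid (free_alg X)\<^esub> x = - x"
          by (simp add: a_inv_def eq_neg_iff_add_eq_0)
        moreover have "relabel \<rho> (- x) = - relabel \<rho> x"
          using relabel_diff[of \<rho> 0 x] by (simp add: relabel_zero)
        ultimately show ?thesis
          using x ideal_free_alg(3)[OF ideal_I x(2)] by simp
      qed
    qed
  next
    fix a x assume "a \<in> ?J" "x \<in> carrier (free_alg X)"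
    then show "x \<otimes>\<^bsub>free_alg X\<^esub> a \<in> ?J"
      using I.I_l_closed[of "relabel \<rho> a" "relabel \<rho> x"] cl[of x] mult_closed[of x X a]
      by (simp add: relabel_mult)
  next
    fix a x assume "a \<in> ?J" "x \<in> carrier (free_alg X)"
    then show "a \<otimes>\<^bsub>free_alg X\<^esub> x \<in> ?J"
      using I.I_r_closed[of "relabel \<rho> a" "relabel \<rho> x"] cl[of x] mult_closed[of a X x]
      by (simp add: relabel_mult)
  qed
  have rels: "tl_rels (2 * n - 1) \<subseteq> carrier (free_alg X)"
    unfolding X_def by (rule tl_rels_closed)
  have "tl_rels (2 * n - 1) \<subseteq> I"
    using ring.genideal_self[OF ring_free_alg rels] by (simp add: I_def rel_ideal_def X_def)
  with rels relabel_tl_rels have "tl_rels (2 * n - 1) \<subseteq> ?J" by blast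
  from ring.genideal_minimal[OF ring_free_alg J this] have "I \<subseteq> ?J"
    by (simp add: I_def rel_ideal_def X_def)
  with assms show ?thesis by blast
qed

private lemma relabel_I: "relabel \<rho> ` I = I"
proof
  show "relabel \<rho> ` I \<subseteq> I" using relabel_I_sub by blast
  interpret I: ideal I "free_alg X" by (rule ideal_I)
  show "I \<subseteq> relabel \<rho> ` I"
  proof
    fix f assume f: "f \<in> I"
    then have "f = relabel \<rho> (relabel \<rho> f)"
      using relabel_involution[of f X \<rho>] rho(2) I.a_Hcarr[OF f] by simp
    then show "f \<in> relabel \<rho> ` I" using relabel_I_sub[OF f] by blast
  qed
qed

private lemma sigma_coset:
  "sigma n (I +>\<^bsub>free_alg X\<^esub> f) = I +>\<^bsub>free_alg X\<^esub> relabel \<rho> f"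
proof -
  have "sigma n (I +>\<^bsub>free_alg X\<^esub> f) = (\<lambda>h. h + relabel \<rho> f) ` relabel \<rho> ` I"
    by (simp add: sigma_def coset_free_alg image_image relabel_add \<rho>_def)
  then show ?thesis by (simp add: relabel_I coset_free_alg)
qed

lemma sigma_tl_gen: "sigma n (tl_gen (2 * n - 1) i) = tl_gen (2 * n - 1) (2 * n - i)"
  using sigma_coset[of "gen i"]
  by (simp add: tl_gen_def presented_gen_def I_def X_def relabel_gen \<rho>_def)

lemma sigma_alg_iso: "sigma n \<in> alg_iso (TL (2 * n - 1)) (TL (2 * n - 1))"
proof -
  let ?A = "TL (2 * n - 1)" and ?c = "\<lambda>f. I +>\<^bsub>free_alg X\<^esub> f"
  have A: "?A = presented X (tl_rels (2 * n - 1))" by (simp add: TL_def X_def)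
  have rels: "tl_rels (2 * n - 1) \<subseteq> carrier (free_alg X)"
    unfolding X_def by (rule tl_rels_closed)
  note P = presented_simps[OF rels, folded A X_def, unfolded X_def[symmetric],
      folded I_def[folded X_def]]
  have cl: "relabel \<rho> g \<in> carrier (free_alg X)" if "g \<in> carrier (free_alg X)" for g
    using relabel_closed[OF that rho(1)] .
  have inv: "sigma n (sigma n x) = x" and clA: "sigma n x \<in> carrier ?A" if "x \<in> carrier ?A" for x
  proof -
    from that obtain f where f: "f \<in> carrier (free_alg X)" "x = ?c f"
      unfolding P(1) by blast
    show "sigma n (sigma n x) = x"
      using relabel_involution[OF f(1) rho(2)] by (simp add: f(2) sigma_coset)
    show "sigma n x \<in> carrier ?A"
      unfolding f(2) sigma_coset P(1) using cl[OF f(1)] by blast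
  qed
  have "sigma n \<in> ring_hom ?A ?A"
  proof (rule ring_hom_memI)
    fix x y assume "x \<in> carrier ?A" "y \<in> carrier ?A"
    then obtain f g where fg: "f \<in> carrier (free_alg X)" "x = ?c f"
      "g \<in> carrier (free_alg X)" "y = ?c g"
      unfolding P(1) by blast
    show "sigma n (x \<otimes>\<^bsub>?A\<^esub> y) = sigma n x \<otimes>\<^bsub>?A\<^esub> sigma n y"
      unfolding fg(2,4) sigma_coset P(4)[OF fg(1,3)] P(4)[OF cl[OF fg(1)] cl[OF fg(3)]]
      by (simp add: relabel_mult)
    show "sigma n (x \<oplus>\<^bsub>?A\<^esub> y) = sigma n x \<oplus>\<^bsub>?A\<^esub> sigma n y"
      unfolding fg(2,4) sigma_coset P(5)[OF fg(1,3)] P(5)[OF cl[OF fg(1)] cl[OF fg(3)]]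
      by (simp add: relabel_add)
  next
    show "sigma n \<one>\<^bsub>?A\<^esub> = \<one>\<^bsub>?A\<^esub>"
      unfolding P(2) sigma_coset relabel_one ..
  qed (rule clA)
  moreover have "sigma n (a \<odot>\<^bsub>?A\<^esub> x) = a \<odot>\<^bsub>?A\<^esub> sigma n x" if "x \<in> carrier ?A" for a x
  proof -
    from that obtain f where f: "x = ?c f"
      unfolding P(1) by blast
    show ?thesis unfolding f sigma_coset P(6) relabel_scal ..
  qed
  moreover have "bij_betw (sigma n) (carrier ?A) (carrier ?A)"
    by (rule bij_betw_byWitness[of _ "sigma n"]) (use inv clA in auto)
  ultimately show ?thesis by (simp add: alg_iso_def alg_hom_def)
qed

end

end

theory Submission
  imports Defs "HOL-Library.Multiset"
begin

text \<open>All defining relations equate monomials \<open>\<delta>\<^sup>k w\<close>, so both algebras are monoid rings over the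
  integers, and it suffices to show that \<open>e\<^sub>i \<mapsto> E\<^bsub>n-i\<^esub> E\<^bsub>n+i\<^esub>\<close> is a bijection from the monoid of
  monomials in the \<open>e\<^sub>i\<close> onto the \<open>\<sigma>\<close>-invariant monomials in the \<open>E\<^sub>i\<close>. In the Temperley-Lieb
  monoid the rules \<open>E\<^sub>i E\<^sub>i \<rightarrow> \<delta> E\<^sub>i\<close> and \<open>E\<^sub>i E\<^sub>j E\<^sub>i \<rightarrow> E\<^sub>i\<close> are confluent modulo commutations, which
  gives every element a normal form \<open>\<delta>\<^sup>k w\<close> with \<open>w\<close> unique up to commutations. A word is
  irreducible iff between any two consecutive occurrences of a letter there are at least two
  occurrences of neighbouring letters; hence a word in the \<open>e\<^sub>i\<close> that the relations of type C do not
  shorten has an irreducible image, from which it can be read off up to commutations: this is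
  injectivity. Conversely, the first letter of a \<open>\<sigma>\<close>-invariant irreducible word can be moved to the
  front together with its mirror image, so that the word is peeled into blocks \<open>E\<^bsub>n-i\<^esub> E\<^bsub>n+i\<^esub>\<close> and
  \<open>E\<^sub>n\<close>.\<close>

section \<open>Words up to commutation\<close>

text \<open>Uniqueness of normal forms in type C is borrowed from type A. Words in the e_i are only
  shortened, with unrecorded powers of \<open>\<delta>\<close>, until their folded image is
  irreducible; the homomorphism to TL then forces exponents and words to agree. The end node decides
  which words can be shortened: one e_0 between two e_1 contributes the single letter E_n, and
  contracting E_{n-1} E_n E_{n-1} leaves a square of E_{n+1}, hence the one factor
  \<open>\<delta>\<close> in e_1 e_0 e_1; one e_1 between two e_0 contributes both neighbours of
  E_n, so the image of e_0 e_1 e_0 is irreducible, in accordance with the absence of a relation for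
  it. Linear combinations are handled by integer-valued functionals. The sum of the coefficients of
  all monomials with a given normal form vanishes on the relation ideal of TL, since each relation
  is a difference of two monomials with equal normal forms. Conversely, an element of the free
  algebra of type C for which all these sums over folded monomials vanish lies in the relation
  ideal, because monomials whose folded normal forms agree are congruent.\<close>

lemma append_Cons_eq_count:
  assumes "x @ i # y = x' @ i # y'" and "count_list x i = count_list x' i"
  shows "x = x' \<and> y = y'"
  using assms
proof (induction x arbitrary: x')
  case Nil
  then show ?case by (cases x') auto
next
  case (Cons a x)
  then show ?case by (cases x') (auto split: if_splits)
qed

lemma count_list_filter: "P i \<Longrightarrow> count_list (filter P xs) i = count_list xs i"
  by (induction xs) auto

lemma split_list_count:
  "m < count_list u i \<Longrightarrow> \<exists>A D. u = A @ i # D \<and> count_list A i = m"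
proof (induction u arbitrary: m)
  case Nil
  then show ?case by simp
next
  case (Cons x u)
  show ?case
  proof (cases "x = i \<and> m = 0")
    case True
    then show ?thesis by (intro exI[of _ "[]"] exI[of _ u]) simp
  next
    case False
    then obtain m' where "m' < count_list u i" "m = (if x = i then Suc m' else m')"
      using Cons.prems by (cases m) (auto split: if_splits)
    with Cons.IH[of m'] obtain A D where "u = A @ i # D" "count_list A i = m'" by blast
    then show ?thesis
      using \<open>m = _\<close> by (intro exI[of _ "x # A"] exI[of _ D]) auto
  qed
qed

locale commutation_graph =
  fixes adj :: "'a \<Rightarrow> 'a \<Rightarrow> bool"
  assumes adj_sym: "adj i j \<Longrightarrow> adj j i"
    and adj_irrefl: "\<not> adj i i"
begin

definition clique :: "('a \<Rightarrow> bool) \<Rightarrow> bool"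
  where "clique P \<longleftrightarrow> (\<forall>x y. P x \<longrightarrow> P y \<longrightarrow> x = y \<or> adj x y)"

text \<open>Adjacent letters are the ones that do not commute. Words are equal in the partially commutative
  monoid iff their projections to all cliques agree; this description makes \<open>\<approx>\<close> visibly a
  cancellative congruence.\<close>

definition eqv :: "'a list \<Rightarrow> 'a list \<Rightarrow> bool"  (infix "\<approx>" 50)
  where "u \<approx> v \<longleftrightarrow> (\<forall>P. clique P \<longrightarrow> filter P u = filter P v)"

definition free_of :: "'a \<Rightarrow> 'a list \<Rightarrow> bool"
  where "free_of i b \<longleftrightarrow> (\<forall>x\<in>set b. x \<noteq> i \<and> \<not> adj i x)"

lemma eqv_refl [simp]: "u \<approx> u"
  and eqv_sym: "u \<approx> v \<Longrightarrow> v \<approx> u"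
  and eqv_trans [trans]: "u \<approx> v \<Longrightarrow> v \<approx> w \<Longrightarrow> u \<approx> w"
  and eqv_append: "u \<approx> v \<Longrightarrow> u' \<approx> v' \<Longrightarrow> u @ u' \<approx> v @ v'"
  and eqv_cancel_left: "a @ u \<approx> a @ v \<Longrightarrow> u \<approx> v"
  by (auto simp: eqv_def)

lemma eqv_Cons: "u \<approx> v \<Longrightarrow> i # u \<approx> i # v"
  by (auto simp: eqv_def)

lemma clique_single: "clique ((=) i)"
  by (simp add: clique_def)

lemma clique_edge: "adj i j \<Longrightarrow> clique (\<lambda>x. x = i \<or> x = j)"
  by (auto simp: clique_def dest: adj_sym)

lemma clique_free_of:
  assumes "clique P" "P i" "free_of i b"
  shows "filter P b = []"
  using assms unfolding clique_def free_of_def filter_empty_conv by blast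

lemma eqv_count: "u \<approx> v \<Longrightarrow> count_list u i = count_list v i"
  using clique_single[of i] by (auto simp: eqv_def count_list_eq_length_filter)

lemma eqv_mset: "u \<approx> v \<Longrightarrow> mset u = mset v"
  by (rule multiset_eqI) (simp add: count_mset eqv_count)

lemma eqv_set: "u \<approx> v \<Longrightarrow> set u = set v"
  using eqv_mset mset_eq_setD by blast

lemma eqv_length: "u \<approx> v \<Longrightarrow> length u = length v"
  using eqv_mset mset_eq_length by blast

lemma eqv_commute:
  assumes "free_of i b"
  shows "b @ [i] \<approx> i # b"
  unfolding eqv_def
proof (intro allI impI)
  fix P assume "clique P"
  then show "filter P (b @ [i]) = filter P (i # b)"
    using clique_free_of[of P i b] assms by auto
qed

lemma eqv_commute_words:
  assumes "\<forall>x\<in>set u. free_of x v"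
  shows "u @ v \<approx> v @ u"
  unfolding eqv_def
proof (intro allI impI)
  fix P assume P: "clique P"
  show "filter P (u @ v) = filter P (v @ u)"
  proof (cases "\<exists>x\<in>set u. P x")
    case True
    then have "filter P v = []" using clique_free_of[OF P] assms by blast
    then show ?thesis by simp
  next
    case False
    then have "filter P u = []" by (simp add: filter_empty_conv)
    then show ?thesis by simp
  qed
qed

lemma eqv_move:
  assumes "free_of i b"
  shows "a @ b @ i # d \<approx> a @ i # b @ d"
  using eqv_append[OF eqv_refl[of a] eqv_append[OF eqv_commute[OF assms] eqv_refl[of d]]] by simp

text \<open>Projecting to an edge {i, x} shows that no neighbour x of i precedes the first i of v,
  so this i commutes to the front and cancels. This turns the definition of \<open>\<approx>\<close>
  by projections into actual swaps of letters, on which inductions over words rest.\<close>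

lemma eqv_ConsD:
  assumes "i # u \<approx> v"
  obtains A B where "v = A @ i # B" "free_of i A" "u \<approx> A @ B"
proof -
  have "i \<in> set v" using eqv_set[OF assms] by auto
  then obtain A B where v: "v = A @ i # B" "i \<notin> set A"
    using split_list_first by metis
  have "x \<notin> set A" if "adj i x" for x
  proof
    assume "x \<in> set A"
    let ?P = "\<lambda>y. y = i \<or> y = x"
    have "filter ?P (i # u) = filter ?P v"
      using assms clique_edge[OF that] unfolding eqv_def by blast
    then have "hd (filter ?P A @ i # filter ?P B) = i" by (simp add: v(1)) (metis list.sel(1))
    moreover have "filter ?P A \<noteq> []" using \<open>x \<in> set A\<close> by (auto simp: filter_empty_conv)
    ultimately have "i \<in> set (filter ?P A)" by (metis hd_append2 hd_in_set)
    then show False using v(2) by simp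
  qed
  then have A: "free_of i A" using v(2) by (auto simp: free_of_def)
  have "i # u \<approx> i # A @ B"
    using eqv_trans[OF assms] eqv_move[OF A, of "[]" B] by (simp add: v(1))
  then have "u \<approx> A @ B" using eqv_cancel_left[of "[i]"] by simp
  with that v(1) A show ?thesis by blast
qed

section \<open>Length-reducing steps modulo commutation\<close>

text \<open>The integer is the exponent of \<open>\<delta>\<close> that is split off.\<close>

inductive step :: "int \<Rightarrow> 'a list \<Rightarrow> 'a list \<Rightarrow> bool" where
  square: "u \<approx> a @ [i, i] @ d \<Longrightarrow> v \<approx> a @ [i] @ d \<Longrightarrow> step 1 u v"
| braid: "u \<approx> a @ [i, j, i] @ d \<Longrightarrow> adj i j \<Longrightarrow> v \<approx> a @ [i] @ d \<Longrightarrow> step 0 u v"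

definition irreducible :: "'a list \<Rightarrow> bool"
  where "irreducible u \<longleftrightarrow> (\<nexists>s v. step s u v)"

lemma step_length: "step s u v \<Longrightarrow> length v < length u"
  by (induction rule: step.induct) (auto dest!: eqv_length)

lemma step_eqv: "step s u v \<Longrightarrow> u' \<approx> u \<Longrightarrow> v' \<approx> v \<Longrightarrow> step s u' v'"
proof (induction rule: step.induct)
  case (square u a i d v)
  show ?case by (rule step.square[of u' a i d v']) (fact square | rule eqv_trans, fact square)+
next
  case (braid u a i j d v)
  show ?case by (rule step.braid[of u' a i j d v']) (fact braid | rule eqv_trans, fact braid)+
qed

lemma step_set: "step s u v \<Longrightarrow> set v \<subseteq> set u"
  by (induction rule: step.induct) (auto dest!: eqv_set)

text \<open>Occurrences of i are matched by their rank, which \<open>\<approx>\<close> preserves. In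
  the projection to a clique containing i the ranks determine the cuts, so the pieces have equal
  projections. A clique without i does not see the cuts, hence the restriction to
  \<open>P i\<close>.\<close>

lemma split_two:
  assumes "u \<approx> a @ i # b @ i # d" "i \<notin> set b"
  obtains A B D where "u = A @ i # B @ i # D" "i \<notin> set B"
    "\<And>P. clique P \<Longrightarrow> P i \<Longrightarrow>
      filter P A = filter P a \<and> filter P B = filter P b \<and> filter P D = filter P d"
proof -
  have c: "count_list u i = Suc (Suc (count_list a i + count_list b i + count_list d i))"
    using eqv_count[OF assms(1), of i] by simp
  then obtain A E where A: "u = A @ i # E" "count_list A i = count_list a i"
    using split_list_count[of "count_list a i" u i] by auto
  have "count_list E i > 0" using c A by simp
  then have "i \<in> set E" using count_list_0_iff[of E i] by auto
  then obtain B D where B: "E = B @ i # D" "i \<notin> set B" using split_list_first by metis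
  have "filter P A = filter P a \<and> filter P B = filter P b \<and> filter P D = filter P d"
    if "clique P" "P i" for P
  proof -
    have "filter P A @ i # filter P E = filter P a @ i # (filter P b @ i # filter P d)"
      using assms(1) that unfolding eqv_def A(1) by auto
    moreover have "count_list (filter P A) i = count_list (filter P a) i"
      using A(2) by (simp add: count_list_filter[of P i] that(2))
    ultimately have "filter P A = filter P a \<and> filter P E = filter P b @ i # filter P d"
      by (rule append_Cons_eq_count)
    then have 1: "filter P A = filter P a" "filter P E = filter P b @ i # filter P d"
      by simp_all
    then have "filter P B @ i # filter P D = filter P b @ i # filter P d"
      using that(2) by (simp add: B(1))
    moreover have "count_list (filter P B) i = count_list (filter P b) i"
      using B(2) assms(2) by (simp add: count_list_filter[of P i] that(2))
    ultimately have "filter P B = filter P b \<and> filter P D = filter P d"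
      by (rule append_Cons_eq_count)
    with 1 show ?thesis by simp
  qed
  with that[of A B D] A(1) B show ?thesis by simp
qed

text \<open>A step is given only up to \<open>\<approx>\<close>; here its redex is located in the
  word u itself, and the result is u with the second i deleted. Cliques through i see equal pieces
  by \<open>split_two\<close>; the other cliques do not see the deleted letter.\<close>

lemma square_split:
  assumes "u \<approx> a @ [i, i] @ d"
  obtains A B D where "u = A @ i # B @ i # D" "free_of i B" "a @ [i] @ d \<approx> A @ i # B @ D"
proof -
  obtain A B D where *: "u = A @ i # B @ i # D" "i \<notin> set B"
    "\<And>P. clique P \<Longrightarrow> P i \<Longrightarrow>
      filter P A = filter P a \<and> filter P B = filter P [] \<and> filter P D = filter P d"
    using split_two[of u a i "[]" d] assms by auto
  have "x \<notin> set B" if "adj i x" for x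
    using *(3)[OF clique_edge[OF that]] by (auto simp: filter_empty_conv)
  with *(2) have B: "free_of i B" by (auto simp: free_of_def)
  have "filter P (a @ [i] @ d) = filter P (A @ i # B @ D)" if "clique P" for P
  proof (cases "P i")
    case True
    then show ?thesis using *(3)[OF that True] by simp
  next
    case False
    have "filter P u = filter P (a @ [i, i] @ d)" using assms that unfolding eqv_def by blast
    then show ?thesis using False by (simp add: *(1))
  qed
  then have "a @ [i] @ d \<approx> A @ i # B @ D" by (simp add: eqv_def)
  with that *(1) B show ?thesis by blast
qed

lemma braid_split:
  assumes "u \<approx> a @ [i, j, i] @ d" "adj i j"
  obtains A B C D where "u = A @ i # B @ j # C @ i # D" "free_of i B" "free_of i C"
    "a @ [i] @ d \<approx> A @ i # B @ C @ D"
proof -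
  have ij: "i \<noteq> j" using assms(2) adj_irrefl by auto
  obtain A E D where *: "u = A @ i # E @ i # D" "i \<notin> set E"
    "\<And>P. clique P \<Longrightarrow> P i \<Longrightarrow>
      filter P A = filter P a \<and> filter P E = filter P [j] \<and> filter P D = filter P d"
    using split_two[of u a i "[j]" d] assms ij by auto
  let ?ij = "\<lambda>x. x = i \<or> x = j"
  have E: "filter ?ij E = [j]" "filter ?ij A = filter ?ij a"
    using *(3)[OF clique_edge[OF assms(2)]] by simp_all
  then have "j \<in> set (filter ?ij E)" by simp
  then have "j \<in> set E" by simp
  then obtain B C where BC: "E = B @ j # C" "j \<notin> set B" using split_list_first by metis
  \<comment> \<open>A clique containing j but not i gives no cut at i, so the j to be deleted must
    be found by its own rank. That rank is read off from the edge {i, j}, where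
    \<open>split_two\<close> does apply.\<close>
  have "count_list (filter ?ij A) j = count_list (filter ?ij a) j" using E(2) by simp
  then have cA: "count_list A j = count_list a j" by (simp add: count_list_filter)
  have "count_list (filter ?ij E) j = 1" using E(1) by simp
  then have "count_list E j = 1" by (simp add: count_list_filter)
  then have "j \<notin> set C" using BC by (simp add: count_list_0_iff)
  moreover have "x \<notin> set E" if "adj i x" "x \<noteq> j" for x
  proof -
    have "filter (\<lambda>y. y = i \<or> y = x) E = filter (\<lambda>y. y = i \<or> y = x) [j]"
      using *(3)[OF clique_edge[OF that(1)]] by blast
    also have "\<dots> = []" using that(2) ij by auto
    finally show ?thesis by (auto simp: filter_empty_conv)
  qed
  ultimately have free: "free_of i B" "free_of i C"
    using BC *(2) by (auto simp: free_of_def)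
  have "filter P (a @ [i] @ d) = filter P (A @ i # B @ C @ D)" if "clique P" for P
  proof (cases "P i")
    case True
    then show ?thesis
      using *(3)[OF that True] clique_free_of[OF that True] free by simp
  next
    case False
    have eq: "filter P u = filter P (a @ [i, j, i] @ d)" using assms that unfolding eqv_def by blast
    show ?thesis
    proof (cases "P j")
      case True
      have "filter P (A @ B) @ j # filter P (C @ D) = filter P a @ j # filter P d"
        using eq True False by (simp add: *(1) BC(1))
      moreover have "count_list (filter P (A @ B)) j = count_list (filter P a) j"
        using cA BC(2) by (simp add: count_list_filter[of P j, OF True] del: filter_append)
      ultimately have "filter P (A @ B) = filter P a \<and> filter P (C @ D) = filter P d"
        by (rule append_Cons_eq_count)
      then show ?thesis using False by simp
    next
      assume "\<not> P j"
      then show ?thesis using eq False by (simp add: *(1) BC(1))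
    qed
  qed
  then have "a @ [i] @ d \<approx> A @ i # B @ C @ D" by (simp add: eqv_def)
  with that[of A B C D] *(1) BC(1) free show ?thesis by simp
qed

section \<open>Local confluence\<close>

text \<open>For local confluence, a reduction is described by the set of positions it deletes, so that the
  letters of the original word keep their names and two reductions can be compared as sets.\<close>

definition subword :: "'a list \<Rightarrow> nat set \<Rightarrow> 'a list"
  where "subword u S = map ((!) u) (filter (\<lambda>k. k \<in> S) [0..<length u])"

lemma subword_all: "{..<length u} \<subseteq> S \<Longrightarrow> subword u S = u"
proof -
  assume "{..<length u} \<subseteq> S"
  then have "filter (\<lambda>k. k \<in> S) [0..<length u] = [0..<length u]"
    by (intro filter_True) auto
  then show ?thesis by (simp add: subword_def map_nth)
qed

lemma filter_upt_split:
  assumes "a \<le> p" "p < b"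
  shows "filter Q [a..<b] = filter Q [a..<p] @ (if Q p then [p] else []) @ filter Q [Suc p..<b]"
proof -
  have "[a..<b] = [a..<p] @ p # [Suc p..<b]"
    using assms by (metis le_Suc_ex less_imp_le_nat upt_add_eq_append upt_conv_Cons)
  then show ?thesis by simp
qed

definition between :: "'a list \<Rightarrow> nat set \<Rightarrow> nat \<Rightarrow> nat \<Rightarrow> nat set"
  where "between u S p q = {r \<in> S. p < r \<and> r < q \<and> adj (u ! p) (u ! r)}"

text \<open>Deleting q together with R covers both rules at once: an empty R is a square, a
  one-element R is a braid. \<open>S\<close> holds the positions that have survived so far, so that
  later redexes are still named by positions of the original word.\<close>

definition redex :: "'a list \<Rightarrow> nat set \<Rightarrow> nat \<Rightarrow> nat \<Rightarrow> nat set \<Rightarrow> bool"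
  where "redex u S p q R \<longleftrightarrow> p \<in> S \<and> q \<in> S \<and> p < q \<and> q < length u \<and> u ! p = u ! q \<and>
    (\<forall>r\<in>S. p < r \<longrightarrow> r < q \<longrightarrow> u ! r \<noteq> u ! p) \<and>
    R = between u S p q \<and> (R = {} \<or> (\<exists>r. R = {r}))"

lemma redexD:
  assumes "redex u S p q R"
  shows "p \<in> S" "q \<in> S" "p < q" "q < length u" "u ! q = u ! p"
    and "r \<in> S \<Longrightarrow> p < r \<Longrightarrow> r < q \<Longrightarrow> u ! r \<noteq> u ! p"
    and "r \<in> R \<longleftrightarrow> r \<in> S \<and> p < r \<and> r < q \<and> adj (u ! p) (u ! r)"
    and "r \<in> R \<Longrightarrow> r' \<in> R \<Longrightarrow> r = r'"
proof -
  show "p \<in> S" "q \<in> S" "p < q" "q < length u" "u ! q = u ! p"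
    using assms by (simp_all add: redex_def)
  show "r \<in> S \<Longrightarrow> p < r \<Longrightarrow> r < q \<Longrightarrow> u ! r \<noteq> u ! p"
    using assms unfolding redex_def by blast
  have "R = between u S p q" using assms by (simp add: redex_def)
  then show "r \<in> R \<longleftrightarrow> r \<in> S \<and> p < r \<and> r < q \<and> adj (u ! p) (u ! r)"
    by (simp add: between_def)
  have "R = {} \<or> (\<exists>r. R = {r})" using assms unfolding redex_def by (elim conjE)
  then show "r \<in> R \<Longrightarrow> r' \<in> R \<Longrightarrow> r = r'" by blast
qed

lemma redexI:
  assumes "p \<in> S" "q \<in> S" "p < q" "q < length u" "u ! q = u ! p"
    and "\<And>r. r \<in> S \<Longrightarrow> p < r \<Longrightarrow> r < q \<Longrightarrow> u ! r \<noteq> u ! p"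
    and "\<And>r. r \<in> R \<longleftrightarrow> r \<in> S \<and> p < r \<and> r < q \<and> adj (u ! p) (u ! r)"
    and "\<And>r r'. r \<in> R \<Longrightarrow> r' \<in> R \<Longrightarrow> r = r'"
  shows "redex u S p q R"
proof -
  have "R = between u S p q" unfolding between_def using assms(7) by blast
  moreover have "R = {} \<or> (\<exists>r. R = {r})" using assms(8) by blast
  ultimately show ?thesis using assms(1-6) by (simp add: redex_def)
qed

definition weight :: "nat set \<Rightarrow> int"
  where "weight R = (if R = {} then 1 else 0)"

text \<open>The pieces A, B, D are fixed before S', so the same pieces describe the words in which
  p, q, or neither has been deleted.\<close>

lemma subword_split:
  assumes "p < q" "q < length u" "u ! p = i" "u ! q = i"
  obtains A B D where "\<And>S'. S' - {p, q} = S - {p, q} \<Longrightarrow>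
      subword u S' = A @ (if p \<in> S' then [i] else []) @ B @ (if q \<in> S' then [i] else []) @ D"
    and "set B = (!) u ` {r \<in> S. p < r \<and> r < q}"
proof
  let ?f = "\<lambda>a b. map ((!) u) (filter (\<lambda>k. k \<in> S) [a..<b])"
  show "subword u S' = ?f 0 p @ (if p \<in> S' then [i] else []) @ ?f (Suc p) q @
      (if q \<in> S' then [i] else []) @ ?f (Suc q) (length u)"
    if S': "S' - {p, q} = S - {p, q}" for S'
  proof -
    have eq: "filter (\<lambda>k. k \<in> S') [a..<b] = filter (\<lambda>k. k \<in> S) [a..<b]"
      if "p \<notin> {a..<b}" "q \<notin> {a..<b}" for a b
      using S' that by (intro filter_cong) auto
    then show ?thesis
      using filter_upt_split[of 0 p "length u" "\<lambda>k. k \<in> S'"]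
        filter_upt_split[of "Suc p" q "length u" "\<lambda>k. k \<in> S'"] assms
        eq[of 0 p] eq[of "Suc p" q] eq[of "Suc q" "length u"]
      by (simp add: subword_def)
  qed
  show "set (?f (Suc p) q) = (!) u ` {r \<in> S. p < r \<and> r < q}"
    by auto
qed

text \<open>The letters in the gap commute with the two equal letters at its ends, so either end may
  be the one that is dropped. This freedom resolves the overlap in
  \<open>join_adjacent\<close>.\<close>

lemma redex_delete_either:
  assumes "redex u S p q {}"
  shows "step 1 (subword u S) (subword u (S - {q}))"
    and "subword u (S - {p}) \<approx> subword u (S - {q})"
proof -
  note d = redexD[OF assms]
  then have r: "p \<in> S" "q \<in> S" "p < q" "q < length u" "u ! p = u ! q"
    by simp_all
  obtain A B D where AB: "\<And>S'. S' - {p, q} = S - {p, q} \<Longrightarrow> subword u S' =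
      A @ (if p \<in> S' then [u ! p] else []) @ B @ (if q \<in> S' then [u ! p] else []) @ D"
    and B: "set B = (!) u ` {r \<in> S. p < r \<and> r < q}"
    using subword_split[OF r(3,4) refl r(5)[symmetric], of S] by blast
  have free: "free_of (u ! p) B"
    using d(6,7) unfolding free_of_def B by auto
  have "subword u S = A @ [u ! p] @ B @ [u ! p] @ D" "subword u (S - {q}) = A @ [u ! p] @ B @ D"
    "subword u (S - {p}) = A @ B @ [u ! p] @ D"
    using AB[of S] AB[of "S - {q}"] AB[of "S - {p}"] r by auto
  moreover have "A @ [u ! p] @ B @ [u ! p] @ D \<approx> A @ [u ! p, u ! p] @ B @ D"
    using eqv_move[OF free, of "A @ [u ! p]" D] by simp
  moreover have "A @ B @ [u ! p] @ D \<approx> A @ [u ! p] @ B @ D"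
    using eqv_move[OF free, of "A" D] by simp
  ultimately show "step 1 (subword u S) (subword u (S - {q}))"
    and "subword u (S - {p}) \<approx> subword u (S - {q})"
    using step.square[of "subword u S" A "u ! p" "B @ D" "subword u (S - {q})"] by simp_all
qed

lemma redex_remove_between:
  assumes "redex u S p q R"
  shows "redex u (S - R) p q {}"
proof (rule redexI)
  note d = redexD[OF assms]
  show "p \<in> S - R" "q \<in> S - R" "p < q" "q < length u" "u ! q = u ! p"
    using d(1-5) d(7)[of p] d(7)[of q] by simp_all
  show "u ! r \<noteq> u ! p" if "r \<in> S - R" "p < r" "r < q" for r
    using d(6)[of r] that by simp
  show "r \<in> {} \<longleftrightarrow> r \<in> S - R \<and> p < r \<and> r < q \<and> adj (u ! p) (u ! r)" for r
    using d(7)[of r] by blast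
qed simp

lemma redex_step:
  assumes "redex u S p q R"
  shows "step (weight R) (subword u S) (subword u (S - R - {q}))"
proof (cases "R = {}")
  case True
  then show ?thesis using redex_delete_either(1) assms by (simp add: weight_def)
next
  case False
  with assms obtain r where R: "R = {r}" by (auto simp: redex_def)
  have *: "p \<in> S" "q \<in> S" "p < q" "q < length u" "u ! p = u ! q"
    using assms by (simp_all add: redex_def)
  have rR: "{r} = between u S p q" using assms R by (simp add: redex_def)
  then have "r \<in> between u S p q" by blast
  then have r: "r \<in> S" "p < r" "r < q" "adj (u ! p) (u ! r)"
    by (simp_all add: between_def)
  have mid: "u ! k \<noteq> u ! p \<and> \<not> adj (u ! p) (u ! k)" if "k \<in> S" "p < k" "k < q" "k \<noteq> r" for k
  proof -
    have "k \<notin> between u S p q" using rR that by blast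
    then have "\<not> adj (u ! p) (u ! k)" using that by (simp add: between_def)
    moreover have "u ! k \<noteq> u ! p" using that assms unfolding redex_def by blast
    ultimately show ?thesis by simp
  qed
  let ?i = "u ! p"
  let ?f = "\<lambda>a b. map ((!) u) (filter (\<lambda>k. k \<in> S) [a..<b])"
  let ?f' = "\<lambda>a b. map ((!) u) (filter (\<lambda>k. k \<in> S - R - {q}) [a..<b])"
  have f': "?f' a b = ?f a b" if "r \<notin> {a..<b}" "q \<notin> {a..<b}" for a b
    using that R by (intro arg_cong[of _ _ "map _"] filter_cong) auto
  have free: "free_of ?i (?f (Suc p) r)" "free_of ?i (?f (Suc r) q)"
    using mid r unfolding free_of_def by auto
  have S: "subword u S = ?f 0 p @ ?i # ?f (Suc p) r @ u ! r # ?f (Suc r) q @ ?i # ?f (Suc q) (length u)"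
    using filter_upt_split[of 0 p "length u" "\<lambda>k. k \<in> S"]
      filter_upt_split[of "Suc p" r "length u" "\<lambda>k. k \<in> S"]
      filter_upt_split[of "Suc r" q "length u" "\<lambda>k. k \<in> S"] * r
    by (simp add: subword_def)
  have "p \<in> S - R - {q}" "r \<notin> S - R - {q}" "q \<notin> S - R - {q}" using * r R by auto
  then have "subword u (S - R - {q}) =
      ?f' 0 p @ ?i # ?f' (Suc p) r @ ?f' (Suc r) q @ ?f' (Suc q) (length u)"
    using filter_upt_split[of 0 p "length u" "\<lambda>k. k \<in> S - R - {q}"]
      filter_upt_split[of "Suc p" r "length u" "\<lambda>k. k \<in> S - R - {q}"]
      filter_upt_split[of "Suc r" q "length u" "\<lambda>k. k \<in> S - R - {q}"] *(1-4) r(1-3)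
    unfolding subword_def by simp
  then have S': "subword u (S - R - {q}) =
      ?f 0 p @ ?i # ?f (Suc p) r @ ?f (Suc r) q @ ?f (Suc q) (length u)"
    using f'[of 0 p] f'[of "Suc p" r] f'[of "Suc r" q] f'[of "Suc q" "length u"] *(3) r(2,3)
    by simp
  have "?f 0 p @ ?i # ?f (Suc p) r @ u ! r # ?f (Suc r) q @ ?i # ?f (Suc q) (length u)
      \<approx> ?f 0 p @ ?f (Suc p) r @ ?i # u ! r # ?f (Suc r) q @ ?i # ?f (Suc q) (length u)"
    by (rule eqv_sym, rule eqv_move[OF free(1)])
  also have "\<dots> \<approx> (?f 0 p @ ?f (Suc p) r) @ [?i, u ! r, ?i] @ (?f (Suc r) q @ ?f (Suc q) (length u))"
    using eqv_move[OF free(2), of "?f 0 p @ ?f (Suc p) r @ [?i, u ! r]"] by simp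
  finally have h1: "subword u S \<approx>
      (?f 0 p @ ?f (Suc p) r) @ [?i, u ! r, ?i] @ (?f (Suc r) q @ ?f (Suc q) (length u))"
    by (simp only: S)
  have h2: "subword u (S - R - {q}) \<approx>
      (?f 0 p @ ?f (Suc p) r) @ [?i] @ (?f (Suc r) q @ ?f (Suc q) (length u))"
    unfolding S' using eqv_sym[OF eqv_move[OF free(1), of "?f 0 p"]] by simp
  show ?thesis using step.braid[OF h1 r(4) h2] by (simp add: R weight_def)
qed

lemma subword_append:
  "subword (u @ v) S = subword u S @ subword v {k. k + length u \<in> S}"
proof -
  have 1: "[0..<length (u @ v)] = [0..<length u] @ map (\<lambda>k. k + length u) [0..<length v]"
    by (simp add: map_add_upt upt_add_eq_append[of 0] add.commute del: upt_Suc)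
  have "map ((!) (u @ v)) (filter (\<lambda>k. k \<in> S) [0..<length u]) = subword u S"
    unfolding subword_def by (intro map_cong) (auto simp: nth_append)
  moreover have "map ((!) (u @ v)) (filter (\<lambda>k. k \<in> S) (map (\<lambda>k. k + length u) [0..<length v])) =
      subword v {k. k + length u \<in> S}"
    unfolding subword_def by (simp add: filter_map comp_def nth_append)
  ultimately show ?thesis unfolding subword_def[of "u @ v"] 1 by simp
qed

lemma subword_single: "subword [i] S = (if 0 \<in> S then [i] else [])"
  by (simp add: subword_def)

text \<open>The split lemmas place every step at actual positions of u. Two arbitrary steps from u
  thus become deletions from one and the same word.\<close>

lemma step_redex:
  assumes "step s u v"
  obtains p q R where "redex u {..<length u} p q R" "s = weight R"
    "v \<approx> subword u ({..<length u} - R - {q})"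
  using assms
proof cases
  case (square a i d)
  obtain A B D where u: "u = A @ i # B @ i # D" and B: "free_of i B"
    and v: "a @ [i] @ d \<approx> A @ i # B @ D"
    using square_split[OF square(2)] by blast
  let ?p = "length A" and ?q = "Suc (length A + length B)" and ?S = "{..<length u}"
  have nth: "u ! ?p = i" "u ! ?q = i"
    by (simp_all add: u nth_append)
  have mid: "u ! k \<in> set B" if "?p < k" "k < ?q" for k
  proof -
    have "k - Suc (length A) < length B" using that by linarith
    then show ?thesis using that by (simp add: u nth_append nth_Cons')
  qed
  have "redex u ?S ?p ?q {}"
    unfolding redex_def between_def nth using mid B by (auto simp: u free_of_def)
  moreover have "subword u (?S - {} - {?q}) = A @ i # B @ D"
  proof -
    have "u = (A @ [i] @ B) @ [i] @ D" by (simp add: u)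
    then show ?thesis
      by (simp only: subword_append subword_single) (simp add: subword_all subset_eq)
  qed
  moreover have "v \<approx> A @ i # B @ D" using square(3) v by (rule eqv_trans)
  ultimately show ?thesis
    using that[of ?p ?q "{}"] square(1) by (simp add: weight_def)
next
  case (braid a i j d)
  obtain A B C D where u: "u = A @ i # B @ j # C @ i # D"
    and BC: "free_of i B" "free_of i C" and v: "a @ [i] @ d \<approx> A @ i # B @ C @ D"
    using braid_split[OF braid(2,3)] by blast
  let ?p = "length A" and ?r = "Suc (length A + length B)"
    and ?q = "Suc (Suc (length A + length B + length C))" and ?S = "{..<length u}"
  have nth: "u ! ?p = i" "u ! ?q = i" "u ! ?r = j"
    by (simp_all add: u nth_append)
  have mid: "u ! k \<in> set B" if "?p < k" "k < ?r" for k
  proof -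
    have "k - Suc (length A) < length B" using that by linarith
    then show ?thesis using that by (simp add: u nth_append nth_Cons')
  qed
  have mid': "u ! k \<in> set C" if "?r < k" "k < ?q" for k
  proof -
    have "k - Suc (Suc (length A + length B)) < length C" "\<not> k - Suc (length A) < length B"
      using that by linarith+
    then show ?thesis using that by (simp add: u nth_append nth_Cons')
  qed
  have free: "u ! k \<noteq> i \<and> \<not> adj i (u ! k)" if "?p < k" "k < ?q" "k \<noteq> ?r" for k
  proof (cases "k < ?r")
    case True
    then show ?thesis using mid[of k] that BC(1) by (simp add: free_of_def)
  next
    case False
    then show ?thesis using mid'[of k] that BC(2) by (simp add: free_of_def)
  qed
  have "?r \<in> ?S" by (simp add: u)
  then have "between u ?S ?p ?q = {?r}"
    unfolding between_def nth using free braid(3) nth(3) by (auto simp: u)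
  moreover have "u ! k \<noteq> i" if "?p < k" "k < ?q" for k
    using free[OF that] nth(3) braid(3) adj_irrefl by (cases "k = ?r") auto
  ultimately have "redex u ?S ?p ?q {?r}"
    unfolding redex_def nth by (auto simp: u)
  moreover have "subword u (?S - {?r} - {?q}) = A @ i # B @ C @ D"
  proof -
    have "u = (A @ [i] @ B) @ [j] @ C @ [i] @ D" by (simp add: u)
    then show ?thesis
      by (simp only: subword_append subword_single) (simp add: subword_all subset_eq)
  qed
  moreover have "v \<approx> A @ i # B @ C @ D" using braid(4) v by (rule eqv_trans)
  ultimately show ?thesis
    using that[of ?p ?q "{?r}"] braid(1) by (simp add: weight_def)
qed

text \<open>A strong form of local confluence: the results agree already, or a single further step
  on each side makes them agree. The exponents are balanced along both paths, so that uniqueness of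
  normal forms will include the power of \<open>\<delta>\<close>.\<close>

definition joins :: "int \<Rightarrow> 'a list \<Rightarrow> int \<Rightarrow> 'a list \<Rightarrow> bool"
  where "joins s v t w \<longleftrightarrow> s = t \<and> v \<approx> w \<or>
    (\<exists>s' t' x. step s' v x \<and> step t' w x \<and> s + s' = t + t')"

lemma joins_sym: "joins s v t w \<Longrightarrow> joins t w s v"
  unfolding joins_def
proof (elim disjE conjE exE)
  assume "s = t" "v \<approx> w"
  then show "t = s \<and> w \<approx> v \<or> (\<exists>s' t' x. step s' w x \<and> step t' v x \<and> t + s' = s + t')"
    by (simp add: eqv_sym)
next
  fix s' t' x
  assume "step s' v x" "step t' w x" "s + s' = t + t'"
  then show "t = s \<and> w \<approx> v \<or> (\<exists>s' t' x. step s' w x \<and> step t' v x \<and> t + s' = s + t')"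
    by (intro disjI2 exI[of _ t'] exI[of _ s'] exI[of _ x]) simp
qed

lemma joins_redexes:
  assumes "redex u (S - R - {q}) a b Q" "redex u (S - R' - {q'}) a' b' Q'"
    and "S - R - {q} - Q - {b} = S - R' - {q'} - Q' - {b'}"
    and "weight R + weight Q = weight R' + weight Q'"
  shows "joins (weight R) (subword u (S - R - {q})) (weight R') (subword u (S - R' - {q'}))"
  unfolding joins_def
  using redex_step[OF assms(1)] redex_step[OF assms(2), folded assms(3)] assms(4)
  by (intro disjI2 exI[of _ "weight Q"] exI[of _ "weight Q'"] exI conjI)

abbreviation join_redexes :: "'a list \<Rightarrow> nat set \<Rightarrow> nat \<Rightarrow> nat set \<Rightarrow> nat \<Rightarrow> nat set \<Rightarrow> bool"
  where "join_redexes u S q R q' R' \<equiv>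
    joins (weight R) (subword u (S - R - {q})) (weight R') (subword u (S - R' - {q'}))"

lemma join_same_letter:
  assumes A: "redex u S p q R" and B: "redex u S p' q' R'"
    and eq: "u ! p = u ! p'" and le: "q \<le> p'"
  shows "join_redexes u S q R q' R'"
proof (rule joins_redexes)
  note a = redexD[OF A] and b = redexD[OF B]
  \<comment> \<open>When the two gaps share the endpoint q = p', the first reduction deletes it, and
    the second redex then starts at p. The neighbours in the first gap are deleted as well, so the
    merged gap still has exactly the neighbours R'.\<close>
  let ?p = "if q = p' then p else p'"
  show "redex u (S - R - {q}) ?p q' R'"
  proof (rule redexI)
    show "r \<in> R' \<longleftrightarrow> r \<in> S - R - {q} \<and> ?p < r \<and> r < q' \<and> adj (u ! ?p) (u ! r)" for r
      using a(3,5) b(3,5) eq le a(7)[of r] b(7)[of r] adj_irrefl[of "u ! p"]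
      by (auto simp: not_less le_less)
    show "u ! r \<noteq> u ! ?p" if "r \<in> S - R - {q}" "?p < r" "r < q'" for r
      using that a(3,5) a(6)[of r] b(6)[of r] eq le by (cases "q = p'"; cases r q rule: linorder_cases) auto
  qed (use a(1-5) a(7) b(1-5) b(8) eq le adj_irrefl in auto)
  show "redex u (S - R' - {q'}) p q R"
  proof (rule redexI)
    show "r \<in> R \<longleftrightarrow> r \<in> S - R' - {q'} \<and> p < r \<and> r < q \<and> adj (u ! p) (u ! r)" for r
      using a(7)[of r] b(7)[of r] b(3) le by auto
  qed (use a b(1-5,7) eq le in auto)
qed (auto)

lemma join_disjoint:
  assumes A: "redex u S p q R" and B: "redex u S p' q' R'"
    and ne: "u ! p \<noteq> u ! p'" and le: "q < p'"
  shows "join_redexes u S q R q' R'"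
proof (rule joins_redexes)
  note a = redexD[OF A] and b = redexD[OF B]
  show "redex u (S - R - {q}) p' q' R'"
  proof (rule redexI)
    show "r \<in> R' \<longleftrightarrow> r \<in> S - R - {q} \<and> p' < r \<and> r < q' \<and> adj (u ! p') (u ! r)" for r
      using a(7)[of r] b(7)[of r] b(3) le by auto
  qed (use a(1-5,7) b le in auto)
  show "redex u (S - R' - {q'}) p q R"
  proof (rule redexI)
    show "r \<in> R \<longleftrightarrow> r \<in> S - R' - {q'} \<and> p < r \<and> r < q \<and> adj (u ! p) (u ! r)" for r
      using a(7)[of r] b(7)[of r] b(3) le by auto
  qed (use a b(1-5,7) le in auto)
qed (auto)

text \<open>The deleted letters are adjacent or equal to \<open>u ! p\<close>, whereas the letter at
  p' and q' is neither, so both ends survive. A neighbour common to R and R' is already gone: the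
  remaining braid then has become a square, on either side alike.\<close>

lemma redex_delete_nonadjacent:
  assumes A: "redex u S p q R" and B: "redex u S p' q' R'"
    and ne: "u ! p \<noteq> u ! p'" "\<not> adj (u ! p) (u ! p')"
  shows "redex u (S - R - {q}) p' q' (R' - R)"
proof (rule redexI)
  note a = redexD[OF A] and b = redexD[OF B]
  show "p' \<in> S - R - {q}" "q' \<in> S - R - {q}"
    using a(5) a(7)[of p'] a(7)[of q'] b(1,2,5) ne by auto
  show "r \<in> R' - R \<longleftrightarrow> r \<in> S - R - {q} \<and> p' < r \<and> r < q' \<and> adj (u ! p') (u ! r)" for r
    using b(7)[of r] a(5) ne(2) adj_sym by auto
qed (use redexD[OF B] in auto)

lemma join_nonadjacent:
  assumes A: "redex u S p q R" and B: "redex u S p' q' R'"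
    and ne: "u ! p \<noteq> u ! p'" "\<not> adj (u ! p) (u ! p')"
  shows "join_redexes u S q R q' R'"
proof (rule joins_redexes)
  show "redex u (S - R - {q}) p' q' (R' - R)" using redex_delete_nonadjacent[OF assms] .
  show "redex u (S - R' - {q'}) p q (R - R')"
    using redex_delete_nonadjacent[OF B A] ne adj_sym by metis
  have "(R = {} \<or> (\<exists>r. R = {r})) \<and> (R' = {} \<or> (\<exists>r. R' = {r}))"
    using A B unfolding redex_def by blast
  then show "weight R + weight (R' - R) = weight R' + weight (R - R')"
    by (auto simp: weight_def)
qed auto

text \<open>A nested gap would contain two neighbours, so overlapping gaps interleave as p < p' < q
  < q', a pattern i j i j. One reduction deletes p' and q, the other q and q'. The results differ
  only in which j survives, and after the deletion of q the two j have no neighbour between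
  them.\<close>

lemma join_adjacent:
  assumes A: "redex u S p q R" and B: "redex u S p' q' R'"
    and adj: "adj (u ! p) (u ! p')" and le: "p < p'"
  shows "join_redexes u S q R q' R'"
proof (cases "q < p'")
  case True
  then show ?thesis using join_disjoint[OF A B] adj adj_irrefl by metis
next
  case False
  note a = redexD[OF A] and b = redexD[OF B]
  have "p' \<noteq> q" using a(5) adj adj_irrefl by metis
  then have "p' < q" using False by simp
  then have p': "p' \<in> R" using a(7) b(1) le adj by blast
  have "q' \<notin> R" using a(8)[OF p', of q'] b(3) by auto
  moreover have "adj (u ! p) (u ! q')" using adj b(5) by simp
  ultimately have "\<not> q' < q" using a(7)[of q'] b(2,3) le by auto
  moreover have "q' \<noteq> q" using a(5) \<open>adj (u ! p) (u ! q')\<close> adj_irrefl by metis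
  ultimately have q': "q < q'" by simp
  then have q: "q \<in> R'" using b(7)[of q] a(2,5) \<open>p' < q\<close> adj_sym[OF adj] by simp
  have R: "R = {p'}" using a(8)[OF p'] p' by blast
  have R': "R' = {q}" using b(8)[OF q] q by blast
  have "redex u (S - {q}) p' q' {}" using redex_remove_between[OF B] by (simp add: R')
  from redex_delete_either(2)[OF this]
  have "subword u (S - {q} - {p'}) \<approx> subword u (S - {q} - {q'})" .
  then show ?thesis
    by (simp add: joins_def R R' weight_def Diff_insert2[symmetric] insert_commute)
qed

lemma join_redexes:
  assumes A: "redex u S p q R" and B: "redex u S p' q' R'"
  shows "join_redexes u S q R q' R'"
proof -
  note a = redexD[OF A] and b = redexD[OF B]
  consider "p = p'" "q = q'" | "u ! p = u ! p'" "q \<le> p'" | "u ! p = u ! p'" "q' \<le> p"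
    | "u ! p \<noteq> u ! p'" "\<not> adj (u ! p) (u ! p')" | "adj (u ! p) (u ! p')" "p < p'"
    | "adj (u ! p) (u ! p')" "p' < p"
  proof -
    \<comment> \<open>A gap joins consecutive occurrences of a letter, so two gaps of the same
      letter coincide or share at most an endpoint.\<close>
    have "q \<le> p' \<or> q' \<le> p \<or> p = p' \<and> q = q'" if "u ! p = u ! p'"
      using a(6)[of p'] a(6)[of q'] b(6)[of p] b(6)[of q] a(1-3,5) b(1-3,5) that
      by (metis linorder_neqE_nat not_less)
    moreover have "p \<noteq> p'" if "adj (u ! p) (u ! p')" using that adj_irrefl by auto
    ultimately show ?thesis using that by (metis linorder_neqE_nat)
  qed
  then show ?thesis
  proof cases
    case 1
    then have "R = R'" using A B by (simp add: redex_def)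
    with 1 show ?thesis by (simp add: joins_def)
  next
    case 2
    then show ?thesis using join_same_letter[OF A B] by simp
  next
    case 3
    then show ?thesis using joins_sym[OF join_same_letter[OF B A]] by simp
  next
    case 4
    then show ?thesis using join_nonadjacent[OF A B] by simp
  next
    case 5
    then show ?thesis using join_adjacent[OF A B] by simp
  next
    case 6
    then show ?thesis using joins_sym[OF join_adjacent[OF B A]] adj_sym by simp
  qed
qed

lemma step_joins:
  assumes "step s u v" "step t u w"
  shows "joins s v t w"
proof -
  obtain p q R where A: "redex u {..<length u} p q R" "s = weight R"
    "v \<approx> subword u ({..<length u} - R - {q})"
    using step_redex[OF assms(1)] .
  obtain p' q' R' where B: "redex u {..<length u} p' q' R'" "t = weight R'"
    "w \<approx> subword u ({..<length u} - R' - {q'})"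
    using step_redex[OF assms(2)] .
  from join_redexes[OF A(1) B(1)] show ?thesis
    unfolding joins_def A(2)[symmetric] B(2)[symmetric]
  proof (elim disjE conjE exE)
    assume "s = t" and "subword u ({..<length u} - R - {q}) \<approx> subword u ({..<length u} - R' - {q'})"
    then show "s = t \<and> v \<approx> w \<or> (\<exists>s' t' x. step s' v x \<and> step t' w x \<and> s + s' = t + t')"
      using eqv_trans[OF A(3) eqv_trans[OF _ eqv_sym[OF B(3)]]] by simp
  next
    fix s' t' x
    assume "step s' (subword u ({..<length u} - R - {q})) x"
      and "step t' (subword u ({..<length u} - R' - {q'})) x" and "s + s' = t + t'"
    then show "s = t \<and> v \<approx> w \<or> (\<exists>s' t' x. step s' v x \<and> step t' w x \<and> s + s' = t + t')"
      using step_eqv[OF _ A(3) eqv_refl] step_eqv[OF _ B(3) eqv_refl] by metis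
  qed
qed

section \<open>Normal forms and keys of monomials\<close>

inductive nf :: "'a list \<Rightarrow> int \<Rightarrow> 'a list \<Rightarrow> bool" where
  stop: "irreducible u \<Longrightarrow> u \<approx> v \<Longrightarrow> nf u 0 v"
| step: "step s u v \<Longrightarrow> nf v t w \<Longrightarrow> nf u (s + t) w"

lemma irreducible_eqv: "irreducible u \<Longrightarrow> u \<approx> v \<Longrightarrow> irreducible v"
  unfolding irreducible_def using step_eqv[OF _ _ eqv_refl] by blast

lemma nf_irreducible: "nf u s v \<Longrightarrow> irreducible v"
  by (induction rule: nf.induct) (auto dest: irreducible_eqv)

lemma nf_set: "nf u s v \<Longrightarrow> set v \<subseteq> set u"
  by (induction rule: nf.induct) (auto dest: eqv_set step_set)

lemma nf_eqv:
  assumes "nf u s v" "u \<approx> u'" "v \<approx> v'"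
  shows "nf u' s v'"
  using assms
proof (induction arbitrary: u' v')
  case (stop u v)
  have "u' \<approx> v'"
    using eqv_trans[OF eqv_sym[OF stop(3)] eqv_trans[OF stop(2,4)]] .
  then show ?case using nf.stop[OF irreducible_eqv[OF stop(1,3)]] by simp
next
  case (step s u v t w)
  have "step s u' v" using step_eqv[OF step(1) eqv_sym[OF step(4)] eqv_refl] .
  then show ?case using nf.step[OF _ step.IH[OF eqv_refl step(5)]] by simp
qed

lemma nf_exists: "\<exists>s v. nf u s v"
proof (induction u rule: measure_induct_rule[of length])
  case (less u)
  show ?case
  proof (cases "irreducible u")
    case True
    then show ?thesis using nf.stop eqv_refl by blast
  next
    case False
    then obtain s v where "step s u v" unfolding irreducible_def by blast
    then show ?thesis using less[OF step_length] nf.step by blast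
  qed
qed

text \<open>Newman's argument by induction on the length, with the exponents carried along. When two
  first steps meet in a word z, a normal form of z is compared with those of both branches, each of
  which is shorter than u.\<close>

lemma nf_unique:
  assumes "nf u s v" "nf u t w"
  shows "s = t \<and> v \<approx> w"
  using assms
proof (induction u arbitrary: s v t w rule: measure_induct_rule[of length])
  case (less u)
  show ?case
  proof (cases "irreducible u")
    case True
    have "s = 0 \<and> u \<approx> v" if "nf u s v" for s v
      using nf.cases[OF that] True unfolding irreducible_def by metis
    then have "s = 0" "t = 0" "u \<approx> v" "u \<approx> w" using less.prems by blast+
    then show ?thesis using eqv_trans[OF eqv_sym[OF \<open>u \<approx> v\<close>]] by simp
  next
    case False
    then have red: "\<exists>s1 x s2. step s1 u x \<and> nf x s2 v \<and> s = s1 + s2" if "nf u s v" for s v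
      using nf.cases[OF that] False by metis
    from red[OF less.prems(1)] obtain s1 x s2
      where x: "step s1 u x" "nf x s2 v" "s = s1 + s2" by blast
    from red[OF less.prems(2)] obtain t1 y t2
      where y: "step t1 u y" "nf y t2 w" "t = t1 + t2" by blast
    from step_joins[OF x(1) y(1)] consider "s1 = t1" "x \<approx> y"
      | s' t' z where "step s' x z" "step t' y z" "s1 + s' = t1 + t'"
      unfolding joins_def by blast
    then show ?thesis
    proof cases
      case 1
      have "nf y s2 v" using nf_eqv[OF x(2) 1(2) eqv_refl] .
      then have "s2 = t2 \<and> v \<approx> w" using less.IH[OF step_length[OF y(1)]] y(2) by blast
      then show ?thesis using 1(1) x(3) y(3) by simp
    next
      case 2
      obtain r z' where z': "nf z r z'" using nf_exists by blast
      have "s2 = s' + r \<and> v \<approx> z'"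
        using less.IH[OF step_length[OF x(1)] x(2) nf.step[OF 2(1) z']] .
      moreover have "t2 = t' + r \<and> w \<approx> z'"
        using less.IH[OF step_length[OF y(1)] y(2) nf.step[OF 2(2) z']] .
      ultimately show ?thesis
        using 2(3) x(3) y(3) eqv_trans[of v z' w, OF _ eqv_sym[of w z']] by simp
    qed
  qed
qed

text \<open>The normal form of \<open>\<delta>\<^sup>k w\<close>; the choice is unique by \<open>nf_unique\<close>.\<close>

definition key :: "int \<Rightarrow> 'a list \<Rightarrow> int \<times> 'a list set"
  where "key k w = (SOME (l, C). \<exists>s v. nf w s v \<and> l = k + s \<and> C = {v'. v \<approx> v'})"

lemma key_nf:
  assumes "nf w s v"
  shows "key k w = (k + s, {v'. v \<approx> v'})"
proof -
  have "\<exists>s v. nf w s v \<and> fst (key k w) = k + s \<and> snd (key k w) = {v'. v \<approx> v'}"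
    unfolding key_def case_prod_unfold
    by (rule someI[of _ "(k + s, {v'. v \<approx> v'})"]) (use assms in auto)
  then obtain t x where x: "nf w t x" "fst (key k w) = k + t" "snd (key k w) = {v'. x \<approx> v'}"
    by blast
  have "t = s" "x \<approx> v" using nf_unique[OF x(1) assms] by simp_all
  moreover have "{v'. x \<approx> v'} = {v'. v \<approx> v'}"
    using eqv_trans[OF \<open>x \<approx> v\<close>] eqv_trans[OF eqv_sym[OF \<open>x \<approx> v\<close>]] by blast
  ultimately show ?thesis using x(2,3) by (simp add: prod_eq_iff)
qed

lemma key_step:
  assumes "step s u v"
  shows "key k u = key (k + s) v"
proof -
  obtain t w where w: "nf v t w" using nf_exists by blast
  show ?thesis using key_nf[OF w, of "k + s"] key_nf[OF nf.step[OF assms w], of k] by simp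
qed

lemma key_eqv:
  assumes "u \<approx> v"
  shows "key k u = key k v"
proof -
  obtain t w where w: "nf v t w" using nf_exists by blast
  show ?thesis using key_nf[OF w, of k] key_nf[OF nf_eqv[OF w eqv_sym[OF assms] eqv_refl], of k] by simp
qed

lemma key_irreducible:
  assumes "key k u = key l v" "irreducible u" "irreducible v"
  shows "k = l" "u \<approx> v"
proof -
  have "(k, {v'. u \<approx> v'}) = (l, {v'. v \<approx> v'})"
    using assms key_nf[OF nf.stop[OF _ eqv_refl]] by simp
  then have "k = l" "{v'. u \<approx> v'} = {v'. v \<approx> v'}" by simp_all
  moreover have "v \<in> {v'. v \<approx> v'}" by simp
  ultimately show "k = l" "u \<approx> v" by blast+
qed

end

section \<open>Presented algebras\<close>

text \<open>The monomials \<open>\<delta>^k w\<close>. As an additive group the free algebra is free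
  on them, and each defining relation is a difference of two of them, up to products with other
  monomials no coefficient but 1 and -1 occurs.\<close>

definition mon :: "int \<Rightarrow> nat list \<Rightarrow> free"
  where "mon k w = Poly_Mapping.single w (Poly_Mapping.single k 1)"

lemma mon_mult: "mon k u * mon l v = mon (k + l) (u @ v)"
  by (simp add: mon_def mult_single plus_list_def)

lemma gen_mon: "gen i = mon 0 [i]"
  by (simp add: gen_def mon_def)

lemma one_mon: "1 = mon 0 []"
  by (simp add: mon_def single_one[symmetric] zero_list_def del: single_one)

lemma scal_mon: "scal (Poly_Mapping.single k 1) f = mon k [] * f"
  by (simp add: scal_def mon_def)

lemma scal_delta: "scal delta f = mon 1 [] * f"
  by (simp add: scal_mon delta_def)

lemma scal_delta_inv: "scal delta_inv f = mon (- 1) [] * f"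
  by (simp add: scal_mon delta_inv_def)

lemma scal_delta2: "scal (delta ^ 2) f = mon 2 [] * f"
  by (simp add: scal_mon[symmetric] delta_def power2_eq_square mult_single)

lemma mon_closed: "set w \<subseteq> X \<Longrightarrow> mon k w \<in> carrier (free_alg X)"
  by (simp add: mon_def)

text \<open>Monomials generate the free algebra as an additive group. Closure under differences,
  starting from zero, yields negatives and sums, and thereby all integer coefficients.\<close>

lemma free_alg_induct [consumes 1, case_names zero mon diff]:
  assumes "f \<in> carrier (free_alg X)"
    and zero: "P 0"
    and mon: "\<And>k w. set w \<subseteq> X \<Longrightarrow> P (mon k w)"
    and diff: "\<And>f g. f \<in> carrier (free_alg X) \<Longrightarrow> g \<in> carrier (free_alg X) \<Longrightarrow>
      P f \<Longrightarrow> P g \<Longrightarrow> P (f - g)"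
  shows "P f"
proof -
  define Q where "Q f \<longleftrightarrow> f \<in> carrier (free_alg X) \<and> P f" for f
  have Q0: "Q 0" using zero by (simp add: Q_def)
  have Qdiff: "Q (f - g)" if "Q f" "Q g" for f g
    using that diff[of f g] diff_closed[of f X g] by (simp add: Q_def)
  have Qadd: "Q (f + g)" if "Q f" "Q g" for f g
    using Qdiff[OF that(1) Qdiff[OF Q0 that(2)]] by simp
  have Qsum: "Q (sum F A)" if "\<And>a. a \<in> A \<Longrightarrow> Q (F a)" for A and F :: "'b \<Rightarrow> free"
    using that by (induction A rule: infinite_finite_induct) (auto simp: Q0 intro: Qadd)
  have Qmon: "Q (mon k w)" if "set w \<subseteq> X" for k w
    using mon[OF that] mon_closed[OF that] by (simp add: Q_def)
  have Qint: "Q (Poly_Mapping.single w (Poly_Mapping.single k n))" if "set w \<subseteq> X" for w k n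
  proof (induction n rule: int_induct[of _ 0])
    case base
    then show ?case by (simp add: Q0)
  next
    case (step1 i)
    then show ?case using Qadd[OF step1(2) Qmon[OF that, of k]] by (simp add: mon_def single_add)
  next
    case (step2 i)
    then show ?case using Qdiff[OF step2(2) Qmon[OF that, of k]] by (simp add: mon_def single_diff)
  qed
  have "Q (Poly_Mapping.single w (Poly_Mapping.lookup f w))" if "w \<in> Poly_Mapping.keys f" for w
  proof -
    let ?c = "Poly_Mapping.lookup f w"
    have w: "set w \<subseteq> X" using assms(1) that by simp
    have c: "?c = (\<Sum>k\<in>Poly_Mapping.keys ?c. Poly_Mapping.single k (Poly_Mapping.lookup ?c k))"
      by (rule poly_mapping_eqI) (simp add: lookup_sum lookup_single when_def sum.delta in_keys_iff)
    have "Poly_Mapping.single w (sum F A) = (\<Sum>k\<in>A. Poly_Mapping.single w (F k))"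
      for A and F :: "int \<Rightarrow> laurent"
      by (induction A rule: infinite_finite_induct) (simp_all add: single_add)
    then show ?thesis
      by (subst c) (simp add: Qsum Qint w)
  qed
  then have "Q (\<Sum>w\<in>Poly_Mapping.keys f. Poly_Mapping.single w (Poly_Mapping.lookup f w))"
    by (rule Qsum)
  then show ?thesis using free_expand[of f] by (simp add: Q_def)
qed

text \<open>The extension of g from monomials to the free algebra that is linear over the integers
  only: g may depend on the exponent of \<open>\<delta>\<close>, so Laurent coefficients are broken
  up as well.\<close>

definition lin :: "(int \<Rightarrow> nat list \<Rightarrow> int) \<Rightarrow> free \<Rightarrow> int"
  where "lin g f = (\<Sum>w\<in>Poly_Mapping.keys f. \<Sum>k\<in>Poly_Mapping.keys (Poly_Mapping.lookup f w).
    Poly_Mapping.lookup (Poly_Mapping.lookup f w) k * g k w)"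

lemma lin_superset:
  assumes "finite A" "Poly_Mapping.keys f \<subseteq> A"
    and "finite B" "\<And>w. Poly_Mapping.keys (Poly_Mapping.lookup f w) \<subseteq> B"
  shows "lin g f = (\<Sum>w\<in>A. \<Sum>k\<in>B. Poly_Mapping.lookup (Poly_Mapping.lookup f w) k * g k w)"
proof -
  have "lin g f = (\<Sum>w\<in>Poly_Mapping.keys f. \<Sum>k\<in>B.
      Poly_Mapping.lookup (Poly_Mapping.lookup f w) k * g k w)"
    unfolding lin_def
    by (intro sum.cong refl sum.mono_neutral_left) (use assms in \<open>auto simp: in_keys_iff\<close>)
  also have "\<dots> = (\<Sum>w\<in>A. \<Sum>k\<in>B. Poly_Mapping.lookup (Poly_Mapping.lookup f w) k * g k w)"
    by (intro sum.mono_neutral_left) (use assms in \<open>auto simp: in_keys_iff\<close>)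
  finally show ?thesis .
qed

lemma lin_zero: "lin g 0 = 0"
  by (simp add: lin_def)

lemma lin_mon: "lin g (mon k w) = g k w"
  by (simp add: lin_def mon_def)

lemma finite_coeff_keys:
  "finite (\<Union>w. Poly_Mapping.keys (Poly_Mapping.lookup (f :: free) w))"
proof -
  have "(\<Union>w. Poly_Mapping.keys (Poly_Mapping.lookup f w)) \<subseteq>
      (\<Union>w\<in>Poly_Mapping.keys f. Poly_Mapping.keys (Poly_Mapping.lookup f w))"
  proof
    fix k assume "k \<in> (\<Union>w. Poly_Mapping.keys (Poly_Mapping.lookup f w))"
    then obtain w where w: "k \<in> Poly_Mapping.keys (Poly_Mapping.lookup f w)" by blast
    then have "w \<in> Poly_Mapping.keys f" by (auto simp: in_keys_iff[of w])
    with w show "k \<in> (\<Union>w\<in>Poly_Mapping.keys f. Poly_Mapping.keys (Poly_Mapping.lookup f w))"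
      by blast
  qed
  then show ?thesis by (rule finite_subset) simp
qed

lemma lin_diff: "lin g (f - h) = lin g f - lin g h"
proof -
  let ?A = "Poly_Mapping.keys f \<union> Poly_Mapping.keys h"
  let ?B = "(\<Union>w. Poly_Mapping.keys (Poly_Mapping.lookup f w)) \<union>
    (\<Union>w. Poly_Mapping.keys (Poly_Mapping.lookup h w))"
  have fin: "finite ?A" "finite ?B" using finite_coeff_keys by simp_all
  have sub: "Poly_Mapping.keys (f - h) \<subseteq> ?A"
    "\<And>w. Poly_Mapping.keys (Poly_Mapping.lookup (f - h) w) \<subseteq> ?B"
    using keys_diff by (fastforce simp: lookup_minus)+
  show ?thesis
    by (subst (1 2 3) lin_superset[of ?A _ ?B])
      (use fin sub in \<open>auto simp: lookup_minus left_diff_distrib sum_subtractf\<close>)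
qed

section \<open>Substituting words for letters\<close>

definition subst :: "(nat \<Rightarrow> nat list) \<Rightarrow> free \<Rightarrow> free"
  where "subst s f = (\<Sum>w\<in>Poly_Mapping.keys f.
    Poly_Mapping.single (concat (map s w)) (Poly_Mapping.lookup f w))"

lemma subst_superset:
  assumes "finite A" "Poly_Mapping.keys f \<subseteq> A"
  shows "subst s f = (\<Sum>w\<in>A. Poly_Mapping.single (concat (map s w)) (Poly_Mapping.lookup f w))"
  unfolding subst_def
  by (rule sum.mono_neutral_left[OF assms]) (simp add: in_keys_iff)

lemma subst_mon: "subst s (mon k w) = mon k (concat (map s w))"
  by (simp add: subst_def mon_def)

lemma subst_zero: "subst s 0 = 0"
  by (simp add: subst_def)

lemma subst_diff: "subst s (f - g) = subst s f - subst s g"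
proof -
  let ?A = "Poly_Mapping.keys f \<union> Poly_Mapping.keys g"
  have "Poly_Mapping.keys (f - g) \<subseteq> ?A" by (rule keys_diff)
  then show ?thesis
    by (simp add: subst_superset[of ?A] lookup_minus single_diff sum_subtractf)
qed

lemma subst_add: "subst s (f + g) = subst s f + subst s g"
  using subst_diff[of s "f + g" g] by (simp add: algebra_simps)

lemma in_free_alg_UNIV: "f \<in> carrier (free_alg UNIV)"
  by simp

lemma subst_mult: "subst s (f * g) = subst s f * subst s g"
  using in_free_alg_UNIV[of f]
proof (induction f rule: free_alg_induct)
  case zero
  then show ?case by (simp add: subst_zero)
next
  case (diff f f')
  then show ?case by (simp add: left_diff_distrib subst_diff del: free_alg_simps)
next
  case (mon k u)
  show ?case
    using in_free_alg_UNIV[of g]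
  proof (induction g rule: free_alg_induct)
    case zero
    then show ?case by (simp add: subst_zero)
  next
    case (diff g g')
    then show ?case by (simp add: right_diff_distrib subst_diff del: free_alg_simps)
  next
    case (mon l v)
    show ?case by (simp add: mon_mult subst_mon)
  qed
qed

lemma subst_one: "subst s 1 = 1"
  by (simp add: one_mon subst_mon)

lemma subst_gen: "subst s (gen i) = mon 0 (s i)"
  by (simp add: gen_mon subst_mon)

lemma subst_scal: "subst s (scal c f) = scal c (subst s f)"
  by (cases "c = 0") (simp_all add: scal_def subst_mult, simp_all add: subst_def)

lemma subst_closed:
  assumes "f \<in> carrier (free_alg X)" "\<And>i. i \<in> X \<Longrightarrow> set (s i) \<subseteq> Y"
  shows "subst s f \<in> carrier (free_alg Y)"
  using assms(1)
proof (induction f rule: free_alg_induct)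
  case zero
  then show ?case by (simp add: subst_zero)
next
  case (mon k w)
  then show ?case unfolding subst_mon using assms(2) by (intro mon_closed) auto
next
  case (diff f g)
  then show ?case unfolding subst_diff by (intro diff_closed)
qed

lemma lin_subst: "lin g (subst s f) = lin (\<lambda>k w. g k (concat (map s w))) f"
  using in_free_alg_UNIV[of f]
  by (induction f rule: free_alg_induct)
    (simp_all add: subst_zero lin_zero subst_mon lin_mon subst_diff lin_diff del: free_alg_simps)

lemma ideal_free_algI:
  assumes "J \<subseteq> carrier (free_alg X)" "0 \<in> J"
    and diff: "\<And>f g. f \<in> J \<Longrightarrow> g \<in> J \<Longrightarrow> f - g \<in> J"
    and l: "\<And>f g. f \<in> J \<Longrightarrow> g \<in> carrier (free_alg X) \<Longrightarrow> g * f \<in> J"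
    and r: "\<And>f g. f \<in> J \<Longrightarrow> g \<in> carrier (free_alg X) \<Longrightarrow> f * g \<in> J"
  shows "ideal J (free_alg X)"
proof (rule idealI[OF ring_free_alg])
  interpret F: ring "free_alg X" by (rule ring_free_alg)
  have neg: "- f \<in> J" if "f \<in> J" for f using diff[OF assms(2) that] by simp
  show "subgroup J (add_monoid (free_alg X))"
  proof
    show "J \<subseteq> carrier (add_monoid (free_alg X))" using assms(1) by simp
    show "\<one>\<^bsub>add_monoid (free_alg X)\<^esub> \<in> J" using assms(2) by simp
    show "f \<otimes>\<^bsub>add_monoid (free_alg X)\<^esub> g \<in> J" if "f \<in> J" "g \<in> J" for f g
      using diff[OF that(1) neg[OF that(2)]] by simp
    show "inv\<^bsub>add_monoid (free_alg X)\<^esub> f \<in> J" if "f \<in> J" for f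
    proof -
      have "\<ominus>\<^bsub>free_alg X\<^esub> f + f = 0"
        using F.l_neg[of f] assms(1) that by auto
      then have "inv\<^bsub>add_monoid (free_alg X)\<^esub> f = - f"
        by (simp add: a_inv_def eq_neg_iff_add_eq_0)
      with neg[OF that] show ?thesis by simp
    qed
  qed
qed (use l r in simp_all)

section \<open>Congruence modulo a relation ideal\<close>

locale presentation =
  fixes X :: "nat set" and R :: "free set"
  assumes rels: "R \<subseteq> carrier (free_alg X)"
begin

abbreviation I :: "free set"
  where "I \<equiv> rel_ideal X R"

abbreviation coset :: "free \<Rightarrow> free set"
  where "coset f \<equiv> I +>\<^bsub>free_alg X\<^esub> f"

definition cong :: "free \<Rightarrow> free \<Rightarrow> bool"
  where "cong f g \<longleftrightarrow> f - g \<in> I"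

lemmas ideal_I = ideal_rel_ideal[OF rels]

lemma I_zero: "0 \<in> I"
  and I_add: "f \<in> I \<Longrightarrow> g \<in> I \<Longrightarrow> f + g \<in> I"
  and I_neg: "f \<in> I \<Longrightarrow> - f \<in> I"
  using ideal_free_alg[OF ideal_I] by blast+

lemma I_diff: "f \<in> I \<Longrightarrow> g \<in> I \<Longrightarrow> f - g \<in> I"
  using I_add[OF _ I_neg] by force

lemma I_mult:
  "f \<in> I \<Longrightarrow> g \<in> carrier (free_alg X) \<Longrightarrow> g * f \<in> I"
  "f \<in> I \<Longrightarrow> g \<in> carrier (free_alg X) \<Longrightarrow> f * g \<in> I"
  using ideal.I_l_closed[OF ideal_I, of f g] ideal.I_r_closed[OF ideal_I, of f g] by simp_all

lemma rel_in_I: "r \<in> R \<Longrightarrow> r \<in> I"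
  using ring.genideal_self[OF ring_free_alg rels] by (auto simp: rel_ideal_def)

lemma I_minimal: "ideal J (free_alg X) \<Longrightarrow> R \<subseteq> J \<Longrightarrow> I \<subseteq> J"
  using ring.genideal_minimal[OF ring_free_alg] by (simp add: rel_ideal_def)

lemma cong_refl: "cong f f"
  by (simp add: cong_def I_zero)

lemma cong_sym: "cong f g \<Longrightarrow> cong g f"
  using I_neg[of "f - g"] by (simp add: cong_def)

lemma cong_trans [trans]: "cong f g \<Longrightarrow> cong g h \<Longrightarrow> cong f h"
  using I_add[of "f - g" "g - h"] by (simp add: cong_def)

lemma coset_eq_iff: "coset f = coset g \<longleftrightarrow> cong f g"
proof
  assume "coset f = coset g"
  moreover have "f \<in> coset f" using I_zero by (force simp: coset_free_alg)
  ultimately obtain h where "h \<in> I" "f = h + g" by (auto simp: coset_free_alg)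
  then show "cong f g" by (simp add: cong_def)
qed (auto simp: cong_def dest: coset_eqI[OF rels])

lemma cong_mon:
  assumes "cong (mon k u) (mon l v)" "set x \<subseteq> X" "set y \<subseteq> X"
  shows "cong (mon (a + k) (x @ u @ y)) (mon (a + l) (x @ v @ y))"
proof -
  have "mon a x * (mon k u - mon l v) * mon 0 y \<in> I"
    using I_mult(2)[OF I_mult(1)[OF _ mon_closed[OF assms(2)]] mon_closed[OF assms(3)]] assms(1)
    by (simp add: cong_def)
  then show ?thesis
    by (simp add: cong_def left_diff_distrib right_diff_distrib mon_mult)
qed

lemma lin_I:
  assumes "f \<in> I"
    and "\<And>r k u l v. r \<in> R \<Longrightarrow> set u \<subseteq> X \<Longrightarrow> set v \<subseteq> X \<Longrightarrow> lin g (mon k u * r * mon l v) = 0"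
  shows "lin g f = 0"
proof -
  \<comment> \<open>Quantifying over both multipliers makes this set a two-sided ideal by
    construction. Linearity in x and y then reduces the test on a relation to monomial
    multipliers.\<close>
  let ?J = "{f \<in> carrier (free_alg X).
    \<forall>x\<in>carrier (free_alg X). \<forall>y\<in>carrier (free_alg X). lin g (x * f * y) = 0}"
  have "ideal ?J (free_alg X)"
  proof (rule ideal_free_algI)
    show "h - h' \<in> ?J" if "h \<in> ?J" "h' \<in> ?J" for h h'
      using that diff_closed[of h X h']
      by (simp add: left_diff_distrib right_diff_distrib lin_diff del: free_alg_simps)
    show "h' * h \<in> ?J" "h * h' \<in> ?J" if "h \<in> ?J" "h' \<in> carrier (free_alg X)" for h h'
      using that mult_closed[of h X h'] mult_closed[of h' X h] mult_closed[of _ X h'] mult_closed[of h' X]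
      by (simp_all add: mult.assoc[symmetric] del: free_alg_simps) (simp add: mult.assoc del: free_alg_simps)
  qed (auto simp: lin_zero simp del: free_alg_simps(1), simp)
  moreover have "r \<in> ?J" if r: "r \<in> R" for r
  proof -
    have "lin g (x * r * y) = 0" if "x \<in> carrier (free_alg X)" "y \<in> carrier (free_alg X)" for x y
      using that(1)
    proof (induction x rule: free_alg_induct)
      case zero
      then show ?case by (simp add: lin_zero)
    next
      case (diff x x')
      then show ?case by (simp add: left_diff_distrib lin_diff del: free_alg_simps)
    next
      case (mon k u)
      from that(2) show ?case
      proof (induction y rule: free_alg_induct)
        case zero
        then show ?case by (simp add: lin_zero)
      next
        case (diff y y')
        then show ?case by (simp add: right_diff_distrib lin_diff del: free_alg_simps)
      next
        case (mon l v)
        with assms(2)[OF r] \<open>set u \<subseteq> X\<close> show ?case by simp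
      qed
    qed
    with r rels show ?thesis by blast
  qed
  ultimately have "I \<subseteq> ?J" by (intro I_minimal) blast+
  with assms(1) have "lin g (1 * f * 1) = 0" using one_closed[of X] by blast
  then show ?thesis by simp
qed

text \<open>Monomials with the same value t of \<open>\<theta>\<close> are congruent to a common
  representative. Modulo the ideal, f is therefore the sum of these representatives weighted by the
  coefficient sums \<open>lin\<close>, all of which vanish.\<close>

lemma in_I_if_lin:
  fixes \<theta> :: "int \<Rightarrow> nat list \<Rightarrow> 'b"
  assumes "f \<in> carrier (free_alg X)"
    and lin: "\<And>t. lin (\<lambda>k w. of_bool (\<theta> k w = t)) f = 0"
    and \<theta>: "\<And>k u l v. set u \<subseteq> X \<Longrightarrow> set v \<subseteq> X \<Longrightarrow> \<theta> k u = \<theta> l v \<Longrightarrow> cong (mon k u) (mon l v)"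
  shows "f \<in> I"
proof -
  define rep where "rep t = (SOME h. \<exists>k w. h = mon k w \<and> set w \<subseteq> X \<and> \<theta> k w = t)" for t
  have rep: "cong (mon k w) (rep (\<theta> k w))" if "set w \<subseteq> X" for k w
  proof -
    have "\<exists>k' w'. rep (\<theta> k w) = mon k' w' \<and> set w' \<subseteq> X \<and> \<theta> k' w' = \<theta> k w"
      unfolding rep_def by (rule someI[of _ "mon k w"]) (use that in blast)
    with \<theta>[OF that] show ?thesis by metis
  qed
  let ?l = "\<lambda>t. lin (\<lambda>k w. of_bool (\<theta> k w = t))"
  \<comment> \<open>The claim is made for every finite superset T' of T, so that the expansions of f
    and g can be subtracted over a common index set.\<close>
  from assms(1) have "\<exists>T. finite T \<and>
    (\<forall>T'. finite T' \<longrightarrow> T \<subseteq> T' \<longrightarrow> cong f (\<Sum>t\<in>T'. of_int (?l t f) * rep t))"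
  proof (induction f rule: free_alg_induct)
    case zero
    then show ?case by (simp add: lin_zero cong_refl) blast
  next
    case (mon k w)
    have "(\<Sum>t\<in>T'. of_int (?l t (mon k w)) * rep t) = rep (\<theta> k w)" if "finite T'" "{\<theta> k w} \<subseteq> T'" for T'
    proof -
      have "(\<Sum>t\<in>T'. of_int (?l t (mon k w)) * rep t) = (\<Sum>t\<in>T'. if \<theta> k w = t then rep t else 0)"
        by (intro sum.cong) (auto simp: lin_mon)
      then show ?thesis using that by simp
    qed
    with rep[OF mon] show ?case by (intro exI[of _ "{\<theta> k w}"]) simp
  next
    case (diff f g)
    then obtain T1 T2 where T: "finite T1" "finite T2"
      "\<And>T'. finite T' \<Longrightarrow> T1 \<subseteq> T' \<Longrightarrow> cong f (\<Sum>t\<in>T'. of_int (?l t f) * rep t)"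
      "\<And>T'. finite T' \<Longrightarrow> T2 \<subseteq> T' \<Longrightarrow> cong g (\<Sum>t\<in>T'. of_int (?l t g) * rep t)"
      by blast
    have "cong (f - g) (\<Sum>t\<in>T'. of_int (?l t (f - g)) * rep t)"
      if "finite T'" "T1 \<union> T2 \<subseteq> T'" for T'
      using I_diff[OF T(3)[of T', unfolded cong_def] T(4)[of T', unfolded cong_def]] that
      by (simp add: cong_def lin_diff left_diff_distrib sum_subtractf algebra_simps)
    with T(1,2) show ?case by (intro exI[of _ "T1 \<union> T2"]) simp
  qed
  then have "cong f 0" using lin by auto
  then show ?thesis by (simp add: cong_def)
qed

lemma cong_head:
  assumes comm: "\<And>i j. i \<in> X \<Longrightarrow> j \<in> X \<Longrightarrow> i \<noteq> j \<Longrightarrow> \<not> adj i j \<Longrightarrow> cong (mon 0 [i, j]) (mon 0 [j, i])"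
    and "set (A @ i # B) \<subseteq> X" "\<forall>x\<in>set A. x \<noteq> i \<and> \<not> adj i x"
  shows "cong (mon k (i # A @ B)) (mon k (A @ i # B))"
  using assms(2,3)
proof (induction A)
  case Nil
  then show ?case by (simp add: cong_refl)
next
  case (Cons a A)
  have "cong (mon 0 [i, a]) (mon 0 [a, i])" using Cons.prems by (intro comm) auto
  then have "cong (mon k (i # a # A @ B)) (mon k (a # i # A @ B))"
    using cong_mon[of 0 "[i, a]" 0 "[a, i]" "[]" "A @ B" k] Cons.prems by simp
  also have "cong (mon k (a # i # A @ B)) (mon k (a # A @ i # B))"
    using cong_mon[of k "i # A @ B" k "A @ i # B" "[a]" "[]" 0] Cons by simp
  finally show ?case by simp
qed

lemma cong_eqv:
  assumes "commutation_graph adj"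
    and comm: "\<And>i j. i \<in> X \<Longrightarrow> j \<in> X \<Longrightarrow> i \<noteq> j \<Longrightarrow> \<not> adj i j \<Longrightarrow> cong (mon 0 [i, j]) (mon 0 [j, i])"
    and "commutation_graph.eqv adj u v" "set u \<subseteq> X"
  shows "cong (mon k u) (mon k v)"
  using assms(3,4)
proof (induction u arbitrary: v)
  interpret commutation_graph adj by (rule assms(1))
  {
    case Nil
    then show ?case using eqv_length[OF Nil(1)] by (simp add: cong_refl)
  next
    case (Cons i u)
    obtain A B where v: "v = A @ i # B" "free_of i A" "u \<approx> A @ B"
      using eqv_ConsD[OF Cons.prems(1)] .
    have "cong (mon k u) (mon k (A @ B))" using Cons.IH[OF v(3)] Cons.prems(2) by simp
    then have "cong (mon k (i # u)) (mon k (i # A @ B))"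
      using cong_mon[of k u k "A @ B" "[i]" "[]" 0] Cons.prems(2) by simp
    also have "cong (mon k (i # A @ B)) (mon k (A @ i # B))"
      using cong_head[of adj A i B k, OF comm] v(2) eqv_set[OF Cons.prems(1)] Cons.prems(2) v(1)
      by (auto simp: free_of_def)
    finally show ?case by (simp add: v(1))
  }
qed

abbreviation algebra :: "(laurent, free set) module"
  where "algebra \<equiv> presented X R"

lemma coset_closed: "f \<in> carrier (free_alg X) \<Longrightarrow> coset f \<in> carrier algebra"
  by (simp only: presented_simps(1)[OF rels] imageI)

lemma coset_diff:
  assumes "f \<in> carrier (free_alg X)" "g \<in> carrier (free_alg X)"
  shows "coset (f - g) = coset f \<oplus>\<^bsub>algebra\<^esub> (- 1) \<odot>\<^bsub>algebra\<^esub> coset g"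
proof -
  have "scal (- 1) g = - g"
    using single_one[where ?'a = "nat list" and ?'b = laurent]
    by (simp add: scal_def single_uminus zero_list_def)
  then show ?thesis
    using presented_simps(5)[OF rels assms(1) scal_closed[OF assms(2), of "- 1"]]
    by (simp add: presented_simps(6)[OF rels])
qed

lemma coset_zero: "coset 0 = 0 \<odot>\<^bsub>algebra\<^esub> coset 1"
  by (simp add: presented_simps(6)[OF rels] scal_def)

lemma coset_mon_Nil: "coset (mon k []) = Poly_Mapping.single k 1 \<odot>\<^bsub>algebra\<^esub> coset 1"
  by (simp add: presented_simps(6)[OF rels] scal_mon)

lemma coset_mon_Cons:
  assumes "i \<in> X" "set w \<subseteq> X"
  shows "coset (mon k (i # w)) = coset (gen i) \<otimes>\<^bsub>algebra\<^esub> coset (mon k w)"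
  using presented_simps(4)[OF rels gen_closed[OF assms(1)] mon_closed[OF assms(2), of k]]
  by (simp add: gen_mon mon_mult)

lemma alg_hom_unique:
  assumes h: "h \<in> alg_hom algebra B" and h': "h' \<in> alg_hom algebra B"
    and gens: "\<And>i. i \<in> X \<Longrightarrow> h (presented_gen X R i) = h' (presented_gen X R i)"
    and x: "x \<in> carrier algebra"
  shows "h x = h' x"
proof -
  note A = presented_simps[OF rels]
  have hom: "g \<in> ring_hom algebra B" "\<And>c x. x \<in> carrier algebra \<Longrightarrow> g (c \<odot>\<^bsub>algebra\<^esub> x) = c \<odot>\<^bsub>B\<^esub> g x"
    if "g \<in> alg_hom algebra B" for g
    using that by (simp_all add: alg_hom_def)
  note smult = hom(2)[OF h] hom(2)[OF h']
  have one: "h (coset 1) = h' (coset 1)"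
    using ring_hom_one[OF hom(1)[OF h]] ring_hom_one[OF hom(1)[OF h']] by (simp add: A(2))
  have c1: "coset 1 \<in> carrier algebra" by (rule coset_closed[OF one_closed])
  have "h (coset f) = h' (coset f)" if "f \<in> carrier (free_alg X)" for f
    using that
  proof (induction f rule: free_alg_induct)
    case zero
    show ?case unfolding coset_zero smult[OF c1] one ..
  next
    case (mon k w)
    then show ?case
    proof (induction w)
      case Nil
      show ?case unfolding coset_mon_Nil smult[OF c1] one ..
    next
      case (Cons i w)
      then have iw: "i \<in> X" "set w \<subseteq> X" by auto
      note cl = coset_closed[OF gen_closed[OF iw(1)]] coset_closed[OF mon_closed[OF iw(2), of k]]
      show ?case
        unfolding coset_mon_Cons[OF iw] ring_hom_mult[OF hom(1)[OF h] cl]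
          ring_hom_mult[OF hom(1)[OF h'] cl]
        using gens[OF iw(1)] Cons.IH[OF iw(2)] by (simp add: presented_gen_def)
    qed
  next
    case (diff f g)
    have "(- 1) \<odot>\<^bsub>algebra\<^esub> coset g \<in> carrier algebra"
      unfolding A(6) using coset_closed[OF scal_closed[OF diff(2)]] .
    note cl = coset_closed[OF diff(1)] this
    show ?case
      unfolding coset_diff[OF diff(1,2)] ring_hom_add[OF hom(1)[OF h] cl]
        ring_hom_add[OF hom(1)[OF h'] cl] smult[OF coset_closed[OF diff(2)]] diff.IH ..
  qed
  with x show ?thesis by (auto simp: A(1))
qed

end

section \<open>Normal forms in the Temperley-Lieb algebra\<close>

definition adjacent :: "nat \<Rightarrow> nat \<Rightarrow> bool"
  where "adjacent i j \<longleftrightarrow> \<bar>int i - int j\<bar> = 1"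

interpretation line: commutation_graph adjacent
  by unfold_locales (auto simp: adjacent_def)

abbreviation line_eqv :: "nat list \<Rightarrow> nat list \<Rightarrow> bool"  (infix "\<approx>" 50)
  where "u \<approx> v \<equiv> line.eqv u v"

section \<open>Folding words of type C into type A\<close>

definition fold_letter :: "nat \<Rightarrow> nat \<Rightarrow> nat list"
  where "fold_letter n i = (if i = 0 then [n] else [n - i, n + i])"

abbreviation fold_word :: "nat \<Rightarrow> nat list \<Rightarrow> nat list"
  where "fold_word n w \<equiv> concat (map (fold_letter n) w)"

lemma fold_word_set: "set w \<subseteq> {..<n} \<Longrightarrow> set (fold_word n w) \<subseteq> {1..2 * n - 1}"
  by (induction w) (auto simp: fold_letter_def)

lemma filter_fold_word_low:
  assumes "set w \<subseteq> {..<n}"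
  shows "filter (\<lambda>x. x \<le> n) (fold_word n w) = map (\<lambda>e. n - e) w"
  using assms by (induction w) (auto simp: fold_letter_def)

lemma filter_fold_word_high:
  assumes "set w \<subseteq> {..<n}"
  shows "filter (\<lambda>x. x \<ge> n) (fold_word n w) = map (\<lambda>e. n + e) w"
  using assms by (induction w) (auto simp: fold_letter_def)

text \<open>The letters at least n of a folded word spell the original word shifted by n. A shifted
  clique is again a clique, so every projection of the original word can be read off from the folded
  one.\<close>

lemma eqv_if_fold_word_eqv:
  assumes "set u \<subseteq> {..<n}" "set v \<subseteq> {..<n}" "fold_word n u \<approx> fold_word n v"
  shows "u \<approx> v"
  unfolding line.eqv_def
proof (intro allI impI)
  fix P assume P: "line.clique P"
  \<comment> \<open>The bound is essential: truncated subtraction would send all letters below n to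
    0.\<close>
  let ?Q = "\<lambda>x. n \<le> x \<and> P (x - n)"
  have "line.clique ?Q"
    unfolding line.clique_def
  proof (intro allI impI)
    fix x y assume "n \<le> x \<and> P (x - n)" "n \<le> y \<and> P (y - n)"
    moreover from this have "x - n = y - n \<or> adjacent (x - n) (y - n)"
      using P unfolding line.clique_def by blast
    ultimately show "x = y \<or> adjacent x y" by (auto simp: adjacent_def of_nat_diff)
  qed
  then have "filter ?Q (fold_word n u) = filter ?Q (fold_word n v)"
    using assms(3) unfolding line.eqv_def by blast
  moreover have "filter ?Q (fold_word n w) = map (\<lambda>e. n + e) (filter P w)" if "set w \<subseteq> {..<n}" for w
  proof -
    have "filter ?Q (fold_word n w) = filter (\<lambda>x. P (x - n)) (filter (\<lambda>x. x \<ge> n) (fold_word n w))"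
      by (simp add: conj_commute)
    then show ?thesis by (simp add: filter_fold_word_high[OF that] filter_map comp_def)
  qed
  ultimately have "map (\<lambda>e. n + e) (filter P u) = map (\<lambda>e. n + e) (filter P v)"
    using assms(1,2) by simp
  then show "filter P u = filter P v" by (simp add: inj_map_eq_map)
qed

section \<open>Keys of monomials in TL\<close>

lemma presentation_TL: "presentation {1..m} (tl_rels m)"
  by unfold_locales (rule tl_rels_closed)

lemma presentation_DTL: "n \<ge> 1 \<Longrightarrow> presentation {..<n} (dtl_rels n)"
  by unfold_locales (rule dtl_rels_closed)

locale tl =
  fixes m :: nat
begin

sublocale presentation "{1..m}" "tl_rels m"
  by (rule presentation_TL)

lemma square:
  assumes "i \<in> {1..m}"
  shows "cong (mon 0 [i, i]) (mon 1 [i])"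
proof -
  have "gen i * gen i - scal delta (gen i) \<in> tl_rels m" using assms unfolding tl_rels_def by blast
  from rel_in_I[OF this] show ?thesis unfolding cong_def gen_mon scal_delta mon_mult by simp
qed

lemma commute:
  assumes "i \<in> {1..m}" "j \<in> {1..m}" "i \<noteq> j" "\<not> adjacent i j"
  shows "cong (mon 0 [i, j]) (mon 0 [j, i])"
proof -
  have "\<bar>int i - int j\<bar> > 1" using assms(3,4) unfolding adjacent_def by linarith
  then have "gen i * gen j - gen j * gen i \<in> tl_rels m"
    using assms(1,2) unfolding tl_rels_def by blast
  from rel_in_I[OF this] show ?thesis unfolding cong_def gen_mon mon_mult by simp
qed

lemma braid:
  assumes "i \<in> {1..m}" "j \<in> {1..m}" "adjacent i j"
  shows "cong (mon 0 [i, j, i]) (mon 0 [i])"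
proof -
  have "gen i * gen j * gen i - gen i \<in> tl_rels m"
    using assms unfolding tl_rels_def adjacent_def by blast
  from rel_in_I[OF this] show ?thesis unfolding cong_def gen_mon mon_mult by simp
qed

lemma eqv_cong: "u \<approx> v \<Longrightarrow> set u \<subseteq> {1..m} \<Longrightarrow> cong (mon k u) (mon k v)"
  using cong_eqv[OF line.commutation_graph_axioms commute] by blast

lemma step_cong:
  assumes "line.step s u v" "set u \<subseteq> {1..m}"
  shows "cong (mon k u) (mon (k + s) v)"
  using assms
proof cases
  case (square a i d)
  have sets: "set a \<subseteq> {1..m}" "set d \<subseteq> {1..m}" "i \<in> {1..m}" "set v \<subseteq> {1..m}"
    using assms(2) line.eqv_set[OF square(2)] line.eqv_set[OF square(3)] by auto
  have "cong (mon k u) (mon k (a @ [i, i] @ d))"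
    using eqv_cong[OF square(2) assms(2)] .
  also have "cong (mon k (a @ [i, i] @ d)) (mon (k + 1) (a @ [i] @ d))"
    using cong_mon[OF tl.square[OF sets(3)] sets(1,2), of k] by simp
  also have "cong (mon (k + 1) (a @ [i] @ d)) (mon (k + 1) v)"
    by (rule eqv_cong[OF line.eqv_sym[OF square(3)]]) (use sets in auto)
  finally show ?thesis by (simp add: square(1))
next
  case (braid a i j d)
  have sets: "set a \<subseteq> {1..m}" "set d \<subseteq> {1..m}" "i \<in> {1..m}" "j \<in> {1..m}" "set v \<subseteq> {1..m}"
    using assms(2) line.eqv_set[OF braid(2)] line.eqv_set[OF braid(4)] by auto
  have "cong (mon k u) (mon k (a @ [i, j, i] @ d))"
    using eqv_cong[OF braid(2) assms(2)] .
  also have "cong (mon k (a @ [i, j, i] @ d)) (mon k (a @ [i] @ d))"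
    using cong_mon[OF tl.braid[OF sets(3,4) braid(3)] sets(1,2), of k] by simp
  also have "cong (mon k (a @ [i] @ d)) (mon k v)"
    by (rule eqv_cong[OF line.eqv_sym[OF braid(4)]]) (use sets in auto)
  finally show ?thesis by (simp add: braid(1))
qed

lemma nf_cong:
  assumes "line.nf u s v" "set u \<subseteq> {1..m}"
  shows "cong (mon k u) (mon (k + s) v)"
  using assms
proof (induction arbitrary: k)
  case (stop u v)
  then show ?case using eqv_cong by simp
next
  case (step s u v t w)
  have "set v \<subseteq> {1..m}" using line.step_set[OF step(1)] step.prems by blast
  from cong_trans[OF step_cong[OF step(1) step.prems] step.IH[OF this]]
  show ?case by (simp add: add.assoc)
qed

text \<open>A relation multiplied by monomials on both sides is a difference of two monomials joined
  by a rewriting step or a commutation. Their keys agree, so the indicator of a key cancels.\<close>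

lemma lin_key_I:
  assumes "f \<in> I"
  shows "lin (\<lambda>k w. of_bool (line.key k w = t)) f = 0"
  using assms
proof (rule lin_I)
  fix r k u l v assume "r \<in> tl_rels m"
  then consider i where "r = gen i * gen i - scal delta (gen i)"
    | i j where "\<bar>int i - int j\<bar> > 1" "r = gen i * gen j - gen j * gen i"
    | i j where "\<bar>int i - int j\<bar> = 1" "r = gen i * gen j * gen i - gen i"
    unfolding tl_rels_def by blast
  then show "lin (\<lambda>k w. of_bool (line.key k w = t)) (mon k u * r * mon l v) = 0"
  proof cases
    case (1 i)
    have "line.key (k + l) (u @ [i, i] @ v) = line.key (k + l + 1) (u @ [i] @ v)"
      by (rule line.key_step[OF line.step.square[OF line.eqv_refl line.eqv_refl]])
    then show ?thesis
      by (simp add: 1 gen_mon scal_delta mon_mult left_diff_distrib right_diff_distrib lin_diff lin_mon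
          add.commute add.left_commute)
  next
    case (2 i j)
    have "u @ [i, j] @ v \<approx> u @ [j, i] @ v"
      using line.eqv_move[of j "[i]" u v] 2(1) by (simp add: line.free_of_def adjacent_def abs_minus_commute)
    from line.key_eqv[OF this, of "k + l"] show ?thesis
      by (simp add: 2 gen_mon mon_mult left_diff_distrib right_diff_distrib lin_diff lin_mon)
  next
    case (3 i j)
    have "line.key (k + l) (u @ [i, j, i] @ v) = line.key (k + l + 0) (u @ [i] @ v)"
      by (rule line.key_step[OF line.step.braid[OF line.eqv_refl _ line.eqv_refl]])
        (simp add: adjacent_def 3(1))
    then show ?thesis
      by (simp add: 3 gen_mon mon_mult left_diff_distrib right_diff_distrib lin_diff lin_mon)
  qed
qed

text \<open>The functional that tests for the key of the first monomial takes the value 1 on it,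
  hence also on the second.\<close>

lemma cong_key:
  assumes "cong (mon k u) (mon l v)"
  shows "line.key k u = line.key l v"
  using lin_key_I[OF assms[unfolded cong_def], of "line.key k u"]
  by (simp add: lin_diff lin_mon split: if_splits)

end

section \<open>Gaps in folded words\<close>

lemma two_occurrences:
  assumes "\<not> line.irreducible u"
  obtains A i B D where "u = A @ i # B @ i # D" "i \<notin> set B"
    "length (filter (adjacent i) B) \<le> 1"
proof -
  from assms obtain s v where "line.step s u v" unfolding line.irreducible_def by blast
  then show ?thesis
  proof cases
    case (square a i d)
    obtain A B D where *: "u = A @ i # B @ i # D" "line.free_of i B"
      using line.square_split[OF square(2)] by metis
    have "filter (adjacent i) B = []" "i \<notin> set B"
      using *(2) by (auto simp: line.free_of_def filter_empty_conv)
    then show ?thesis using that *(1) by simp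
  next
    case (braid a i j d)
    obtain A B C D where *: "u = A @ i # B @ j # C @ i # D" "line.free_of i B" "line.free_of i C"
      using line.braid_split[OF braid(2,3)] by metis
    have "filter (adjacent i) B = []" "filter (adjacent i) C = []" "i \<notin> set (B @ j # C)"
      using *(2,3) braid(3) by (auto simp: line.free_of_def filter_empty_conv adjacent_def)
    then show ?thesis using that[of A i "B @ j # C" D] *(1) by simp
  qed
qed

lemma map_split_two:
  assumes "map f w = A @ x # B @ x # D" "inj_on f (set w)"
  obtains a e b d where "w = a @ e # b @ e # d" "x = f e" "map f b = B"
proof -
  from assms(1) obtain a w1 where 1: "w = a @ w1" "map f w1 = x # B @ x # D"
    by (auto simp: map_eq_append_conv)
  then obtain e w2 where 2: "w1 = e # w2" "f e = x" "map f w2 = B @ x # D"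
    by auto
  then obtain b w3 where 3: "w2 = b @ w3" "map f b = B" "map f w3 = x # D"
    by (auto simp: map_eq_append_conv)
  then obtain e' d where 4: "w3 = e' # d" "f e' = x" by auto
  have "e \<in> set w" "e' \<in> set w" using 1 2 3 4 by simp_all
  then have "e = e'" using inj_onD[OF assms(2)] 2(2) 4(2) by metis
  with that 1 2 3 4 show ?thesis by simp
qed

text \<open>The letters \<open>\<le> n\<close> of a folded word, and likewise the letters \<open>\<ge> n\<close>, form a relabelled copy of
  the word itself, so gaps can be compared in one half of the line at a time.\<close>

lemma half_gap:
  assumes w: "set w \<subseteq> {..<n}" "filter H (fold_word n w) = map f w"
    and f: "inj_on f {..<n}" "\<And>x y. x < n \<Longrightarrow> y < n \<Longrightarrow> adjacent (f x) (f y) \<longleftrightarrow> adjacent x y"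
    and u: "fold_word n w = A @ i # B @ i # D" "i \<notin> set B" "H i"
  obtains a e b d where "w = a @ e # b @ e # d" "e \<notin> set b" "i = f e"
    "length (filter (adjacent e) b) = length (filter H (filter (adjacent i) B))"
proof -
  have "map f w = filter H A @ i # filter H B @ i # filter H D"
    using w(2) u(1,3) by simp
  moreover have "inj_on f (set w)" using f(1) w(1) by (rule inj_on_subset)
  ultimately obtain a e b d where *: "w = a @ e # b @ e # d" "i = f e" "map f b = filter H B"
    by (rule map_split_two)
  have set: "set b \<subseteq> {..<n}" "e < n" using w(1) *(1) by auto
  have "f e \<notin> set (map f b)" unfolding *(3) using u(2) *(2) by simp
  then have "e \<notin> set b" by auto
  moreover have "filter (adjacent e) b = filter (\<lambda>x. adjacent i (f x)) b"
    by (rule filter_cong) (use set *(2) f(2) in auto)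
  then have "length (filter (adjacent e) b) = length (filter (adjacent i) (map f b))"
    by (simp add: filter_map comp_def)
  then have "length (filter (adjacent e) b) = length (filter H (filter (adjacent i) B))"
    by (simp add: *(3) conj_commute)
  ultimately show ?thesis using that *(1,2) by blast
qed

text \<open>For a letter i other than n the gap is read on the side of the line on which i lies,
  where it is a gap of the original word with at most one neighbour. For i = n the gap misses n - 1
  or n + 1 and is read on a side where the neighbour is missing; this gives the stricter bound 0 for
  e_0.\<close>

lemma fold_word_reducible:
  assumes "n \<ge> 1" "set w \<subseteq> {..<n}" "\<not> line.irreducible (fold_word n w)"
  obtains a e b d where "w = a @ e # b @ e # d" "e \<notin> set b"
    "length (filter (adjacent e) b) \<le> (if e = 0 then 0 else 1)"
proof -
  obtain A i B D where u: "fold_word n w = A @ i # B @ i # D" "i \<notin> set B"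
    "length (filter (adjacent i) B) \<le> 1"
    using two_occurrences[OF assms(3)] .
  have le: "length (filter H (filter (adjacent i) B)) \<le> 1" for H
    using u(3) length_filter_le[of H "filter (adjacent i) B"] by linarith
  have low: "\<exists>a e b d. w = a @ e # b @ e # d \<and> e \<notin> set b \<and> i = n - e \<and>
    length (filter (adjacent e) b) = length (filter (\<lambda>x. x \<le> n) (filter (adjacent i) B))" if "i \<le> n"
    by (rule half_gap[OF assms(2) filter_fold_word_low[OF assms(2)] _ _ u(1,2) that])
      (auto simp: inj_on_def adjacent_def of_nat_diff)
  have high: "\<exists>a e b d. w = a @ e # b @ e # d \<and> e \<notin> set b \<and> i = n + e \<and>
    length (filter (adjacent e) b) = length (filter (\<lambda>x. x \<ge> n) (filter (adjacent i) B))" if "i \<ge> n"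
    by (rule half_gap[OF assms(2) filter_fold_word_high[OF assms(2)] _ _ u(1,2) that])
      (auto simp: inj_on_def adjacent_def)
  \<comment> \<open>If both neighbours of n occurred in the gap, it would contain two neighbouring
    letters, against the bound from \<open>two_occurrences\<close>.\<close>
  consider "i < n" | "i > n" | "i = n" "n - 1 \<notin> set B" | "i = n" "Suc n \<notin> set B"
  proof -
    have False if "i = n" "n - 1 \<in> set B" "Suc n \<in> set B"
    proof -
      have "{n - 1, Suc n} \<subseteq> set (filter (adjacent i) B)"
        using that assms(1) by (auto simp: adjacent_def of_nat_diff)
      then have "card {n - 1, Suc n} \<le> length (filter (adjacent i) B)"
        by (meson List.finite_set card_length card_mono le_trans)
      then show False using u(3) by simp
    qed
    then show ?thesis using that by fastforce
  qed
  then show ?thesis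
  proof cases
    case 1
    then obtain a e b d where *: "w = a @ e # b @ e # d" "e \<notin> set b" "i = n - e"
      "length (filter (adjacent e) b) = length (filter (\<lambda>x. x \<le> n) (filter (adjacent i) B))"
      using low by auto
    then have "e \<noteq> 0" using 1 by auto
    then show ?thesis using that[OF *(1,2)] *(4) le[of "\<lambda>x. x \<le> n"] by simp
  next
    case 2
    then obtain a e b d where *: "w = a @ e # b @ e # d" "e \<notin> set b" "i = n + e"
      "length (filter (adjacent e) b) = length (filter (\<lambda>x. x \<ge> n) (filter (adjacent i) B))"
      using high by auto
    then have "e \<noteq> 0" using 2 by auto
    then show ?thesis using that[OF *(1,2)] *(4) le[of "\<lambda>x. x \<ge> n"] by simp
  next
    case 3
    then obtain a e b d where *: "w = a @ e # b @ e # d" "e \<notin> set b"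
      "length (filter (adjacent e) b) = length (filter (\<lambda>x. x \<le> n) (filter (adjacent i) B))"
      using low by auto
    have "x \<notin> set B" if "adjacent i x" "x \<le> n" for x
    proof -
      have "x = n - 1" using that 3(1) by (auto simp: adjacent_def)
      then show ?thesis using 3(2) by simp
    qed
    then have "filter (\<lambda>x. x \<le> n) (filter (adjacent i) B) = []" by (auto simp: filter_empty_conv)
    then show ?thesis using that[OF *(1,2)] *(3) by simp
  next
    case 4
    then obtain a e b d where *: "w = a @ e # b @ e # d" "e \<notin> set b"
      "length (filter (adjacent e) b) = length (filter (\<lambda>x. x \<ge> n) (filter (adjacent i) B))"
      using high by auto
    have "x \<notin> set B" if "adjacent i x" "x \<ge> n" for x
    proof -
      have "x = Suc n" using that 4(1) by (auto simp: adjacent_def)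
      then show ?thesis using 4(2) by simp
    qed
    then have "filter (\<lambda>x. x \<ge> n) (filter (adjacent i) B) = []" by (auto simp: filter_empty_conv)
    then show ?thesis using that[OF *(1,2)] *(3) by simp
  qed
qed

section \<open>The isomorphism\<close>

locale dtl =
  fixes n :: nat
  assumes n: "n \<ge> 1"
begin

sublocale D: presentation "{..<n}" "dtl_rels n"
  by (rule presentation_DTL[OF n])

sublocale T: tl "2 * n - 1" .

text \<open>The exponent, 1 for e_0 and 2 otherwise, is left open here and in
  \<open>D_braid\<close>: in \<open>key_D_cong\<close> the comparison of keys in TL recovers the
  total exponent.\<close>

lemma D_square:
  assumes "i < n"
  shows "\<exists>s. D.cong (mon 0 [i, i]) (mon s [i])"
proof (cases "i = 0")
  case True
  have "gen 0 * gen 0 - scal delta (gen 0) \<in> dtl_rels n" unfolding dtl_rels_def by blast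
  from D.rel_in_I[OF this] show ?thesis
    unfolding D.cong_def gen_mon scal_delta mon_mult True by (intro exI[of _ 1]) simp
next
  case False
  then have "gen i * gen i - scal (delta ^ 2) (gen i) \<in> dtl_rels n"
    using assms unfolding dtl_rels_def by fastforce
  from D.rel_in_I[OF this] show ?thesis
    unfolding D.cong_def gen_mon scal_delta2 mon_mult by (intro exI[of _ 2]) simp
qed

lemma D_commute:
  assumes "i \<in> {..<n}" "j \<in> {..<n}" "i \<noteq> j" "\<not> adjacent i j"
  shows "D.cong (mon 0 [i, j]) (mon 0 [j, i])"
proof -
  have "\<bar>int i - int j\<bar> > 1" using assms(3,4) unfolding adjacent_def by linarith
  then have "gen i * gen j - gen j * gen i \<in> dtl_rels n"
    using assms(1,2) unfolding dtl_rels_def by blast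
  from D.rel_in_I[OF this] show ?thesis unfolding D.cong_def gen_mon mon_mult by simp
qed

text \<open>The condition on i excludes e_0 e_1 e_0, for which there is no relation.\<close>

lemma D_braid:
  assumes "i < n" "j < n" "adjacent i j" "i \<noteq> 0"
  shows "\<exists>s. D.cong (mon 0 [i, j, i]) (mon s [i])"
proof (cases "j = 0")
  case True
  then have "i = 1" "2 \<le> n" using assms by (auto simp: adjacent_def)
  then have "gen 1 * gen 0 * gen 1 - scal delta (gen 1) \<in> dtl_rels n"
    unfolding dtl_rels_def by simp
  from D.rel_in_I[OF this] show ?thesis
    unfolding D.cong_def gen_mon scal_delta mon_mult True \<open>i = 1\<close> by (intro exI[of _ 1]) simp
next
  case False
  then have "1 \<le> i" "1 \<le> j" using assms(4) by simp_all
  then have "gen i * gen j * gen i - gen i \<in> dtl_rels n"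
    using assms unfolding dtl_rels_def adjacent_def by blast
  from D.rel_in_I[OF this] show ?thesis
    unfolding D.cong_def gen_mon mon_mult by (intro exI[of _ 0]) simp
qed

lemma D_eqv: "u \<approx> v \<Longrightarrow> set u \<subseteq> {..<n} \<Longrightarrow> D.cong (mon k u) (mon k v)"
  using D.cong_eqv[OF line.commutation_graph_axioms D_commute] by blast

lemma D_shorten:
  assumes "set w \<subseteq> {..<n}" "\<not> line.irreducible (fold_word n w)"
  obtains s v where "set v \<subseteq> {..<n}" "length v < length w" "D.cong (mon 0 w) (mon s v)"
proof -
  obtain a e b d where w: "w = a @ e # b @ e # d" "e \<notin> set b"
    and le: "length (filter (adjacent e) b) \<le> (if e = 0 then 0 else 1)"
    using fold_word_reducible[OF n assms] .
  have sets: "set a \<subseteq> {..<n}" "set b \<subseteq> {..<n}" "set d \<subseteq> {..<n}" "e < n"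
    using assms(1) w(1) by auto
  show ?thesis
  proof (cases "filter (adjacent e) b")
    case Nil
    then have free: "line.free_of e b"
      using w(2) by (auto simp: line.free_of_def filter_empty_conv)
    obtain s where s: "D.cong (mon 0 [e, e]) (mon s [e])" using D_square[OF sets(4)] by blast
    have "w \<approx> a @ [e, e] @ b @ d"
      using line.eqv_move[OF free, of "a @ [e]" d] by (simp add: w(1))
    from D_eqv[OF this assms(1)] have "D.cong (mon 0 w) (mon 0 (a @ [e, e] @ b @ d))" .
    also have "D.cong (mon 0 (a @ [e, e] @ b @ d)) (mon s (a @ [e] @ b @ d))"
      using D.cong_mon[OF s, of a "b @ d" 0] sets by simp
    finally show ?thesis using that[of "a @ [e] @ b @ d" s] sets by (simp add: w(1))
  next
    case (Cons j js)
    \<comment> \<open>For e = 0 the bound on neighbours is 0, so a nonempty gap forces e to be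
      positive and makes \<open>D_braid\<close> applicable.\<close>
    then have e: "e \<noteq> 0" "filter (adjacent e) b = [j]" using le by (auto split: if_splits)
    obtain b1 b2 where b: "b = b1 @ j # b2" "\<forall>x\<in>set b1. \<not> adjacent e x" "adjacent e j"
      "filter (adjacent e) b2 = []"
      using filter_eq_ConsD[OF e(2)] by auto
    have free: "line.free_of e b1" "line.free_of e b2"
      using w(2) b by (auto simp: line.free_of_def filter_empty_conv)
    have j: "j < n" "set b1 \<subseteq> {..<n}" "set b2 \<subseteq> {..<n}" using sets(2) b(1) by auto
    obtain s where s: "D.cong (mon 0 [e, j, e]) (mon s [e])"
      using D_braid[OF sets(4) j(1) b(3) e(1)] by blast
    have "w \<approx> a @ b1 @ e # j # b2 @ e # d"
      using line.eqv_sym[OF line.eqv_move[OF free(1), of a]] by (simp add: w(1) b(1))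
    also have "\<dots> \<approx> a @ b1 @ [e, j, e] @ b2 @ d"
      using line.eqv_move[OF free(2), of "a @ b1 @ [e, j]"] by simp
    finally have "w \<approx> (a @ b1) @ [e, j, e] @ (b2 @ d)" by simp
    from D_eqv[OF this assms(1)] have "D.cong (mon 0 w) (mon 0 ((a @ b1) @ [e, j, e] @ (b2 @ d)))" .
    also have "D.cong (mon 0 ((a @ b1) @ [e, j, e] @ (b2 @ d))) (mon s ((a @ b1) @ [e] @ (b2 @ d)))"
      using D.cong_mon[OF s, of "a @ b1" "b2 @ d" 0] sets j by simp
    finally show ?thesis
      using that[of "(a @ b1) @ [e] @ (b2 @ d)" s] sets j by (simp add: w(1) b(1))
  qed
qed

lemma D_reduce:
  assumes "set w \<subseteq> {..<n}"
  shows "\<exists>s v. set v \<subseteq> {..<n} \<and> D.cong (mon 0 w) (mon s v) \<and> line.irreducible (fold_word n v)"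
  using assms
proof (induction w rule: measure_induct_rule[of length])
  case (less w)
  show ?case
  proof (cases "line.irreducible (fold_word n w)")
    case True
    then show ?thesis using less.prems D.cong_refl by blast
  next
    case False
    obtain s v where v: "set v \<subseteq> {..<n}" "length v < length w" "D.cong (mon 0 w) (mon s v)"
      using D_shorten[OF less.prems False] .
    obtain t x where x: "set x \<subseteq> {..<n}" "D.cong (mon 0 v) (mon t x)"
      "line.irreducible (fold_word n x)"
      using less.IH[OF v(2,1)] by blast
    have "D.cong (mon s v) (mon (s + t) x)"
      using D.cong_mon[OF x(2), of "[]" "[]" s] by simp
    with v(3) x show ?thesis using D.cong_trans by blast
  qed
qed

section \<open>The homomorphism and its injectivity\<close>

abbreviation \<Phi> :: "free \<Rightarrow> free"
  where "\<Phi> \<equiv> subst (fold_letter n)"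

lemma \<Phi>_closed: "f \<in> carrier (free_alg {..<n}) \<Longrightarrow> \<Phi> f \<in> carrier (free_alg {1..2 * n - 1})"
  by (erule subst_closed) (use fold_word_set[of "[_]" n] in auto)

lemma fold_pair:
  assumes "1 \<le> i" "i < n"
  shows "n - i \<in> {1..2 * n - 1}" "n + i \<in> {1..2 * n - 1}" "n - i \<noteq> n + i" "\<not> adjacent (n - i) (n + i)"
    "fold_letter n i = [n - i, n + i]"
  using assms by (auto simp: adjacent_def fold_letter_def of_nat_diff)

lemma T_square_pair:
  assumes "a \<in> {1..2 * n - 1}" "c \<in> {1..2 * n - 1}" "a \<noteq> c" "\<not> adjacent a c"
  shows "T.cong (mon 0 [a, c, a, c]) (mon 2 [a, c])"
proof -
  have "[a, c, a, c] \<approx> [] @ [a, a] @ [c, c]"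
    using line.eqv_move[of a "[c]" "[a]" "[c]"] assms by (simp add: line.free_of_def)
  from T.step_cong[OF line.step.square[OF this line.eqv_refl], of 0]
  have "T.cong (mon 0 [a, c, a, c]) (mon 1 [a, c, c])" using assms by simp
  also have "T.cong (mon 1 [a, c, c]) (mon 2 [a, c])"
    using T.step_cong[OF line.step.square[of "[a, c, c]" "[a]" c "[]", OF _ line.eqv_refl], of 1] assms
    by simp
  finally show ?thesis .
qed

lemma \<Phi>_rel:
  assumes "r \<in> dtl_rels n"
  shows "\<Phi> r \<in> T.I"
proof -
  have nn: "n \<in> {1..2 * n - 1}" using n by auto
  consider "r = gen 0 * gen 0 - scal delta (gen 0)"
    | i where "1 \<le> i" "i < n" "r = gen i * gen i - scal (delta ^ 2) (gen i)"
    | i j where "i < n" "j < n" "\<bar>int i - int j\<bar> > 1" "r = gen i * gen j - gen j * gen i"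
    | i j where "1 \<le> i" "i < n" "1 \<le> j" "j < n" "\<bar>int i - int j\<bar> = 1"
        "r = gen i * gen j * gen i - gen i"
    | "2 \<le> n" "r = gen 1 * gen 0 * gen 1 - scal delta (gen 1)"
    using assms unfolding dtl_rels_def by (auto split: if_splits)
  then show ?thesis
  proof cases
    case 1
    show ?thesis using T.square[OF nn]
      unfolding T.cong_def 1 subst_diff subst_mult subst_scal subst_gen subst_mon scal_delta mon_mult
      by (simp add: fold_letter_def)
  next
    case (2 i)
    note p = fold_pair[OF 2(1,2)]
    show ?thesis using T_square_pair[OF p(1-4)]
      unfolding T.cong_def 2(3) subst_diff subst_mult subst_scal subst_gen subst_mon scal_delta2 mon_mult p(5)
      by simp
  next
    case (3 i j)
    have "\<forall>x\<in>set (fold_letter n i). line.free_of x (fold_letter n j)"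
      using 3(1-3) by (auto simp: fold_letter_def line.free_of_def adjacent_def of_nat_diff)
    from T.eqv_cong[OF line.eqv_commute_words[OF this], of 0]
    have "T.cong (mon 0 (fold_letter n i @ fold_letter n j)) (mon 0 (fold_letter n j @ fold_letter n i))"
      using fold_word_set[of "[i]" n] fold_word_set[of "[j]" n] 3(1,2) by simp
    then show ?thesis
      unfolding T.cong_def 3(4) subst_diff subst_mult subst_gen mon_mult by simp
  next
    case (4 i j)
    note p = fold_pair[OF 4(1,2)] and q = fold_pair[OF 4(3,4)]
    define a c x y where "a = n - i" and "c = n + i" and "x = n - j" and "y = n + j"
    note defs = a_def c_def x_def y_def
    note p = p[folded defs] and q = q[folded defs]
    have ax: "adjacent a x" "adjacent c y"
      using 4(1-5) by (auto simp: adjacent_def defs of_nat_diff)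
    have free: "line.free_of a [c]" "line.free_of a [c, y]" "line.free_of c [x]" "line.free_of x [c]"
      using 4(1-5) by (auto simp: line.free_of_def adjacent_def defs of_nat_diff)
    have "[a, c, x, y, a, c] \<approx> [a, x, c, y, a, c]"
      using line.eqv_move[OF free(4), of "[a]" "[y, a, c]"] by simp
    also have "[a, x, c, y, a, c] \<approx> [] @ [a, x, a] @ [c, y, c]"
      using line.eqv_move[OF free(2), of "[a, x]" "[c]"] by simp
    finally have "T.cong (mon 0 [a, c, x, y, a, c]) (mon (0 + 0) ([] @ [a] @ [c, y, c]))"
      by (intro T.step_cong line.step.braid[OF _ ax(1) line.eqv_refl]) (use p q in auto)
    also have "T.cong (mon (0 + 0) ([] @ [a] @ [c, y, c])) (mon (0 + 0 + 0) ([a] @ [c] @ []))"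
      by (intro T.step_cong line.step.braid[OF _ ax(2) line.eqv_refl]) (use p q in auto)
    finally show ?thesis
      unfolding T.cong_def 4(6) subst_diff subst_mult subst_gen mon_mult p(5) q(5) by simp
  next
    case 5
    \<comment> \<open>The braid contracts E_{n-1} E_n E_{n-1} and leaves E_{n+1} on both sides of
      E_{n-1}. These two commute together, and their square supplies the single
      \<open>\<delta>\<close>.\<close>
    define a c where "a = n - 1" and "c = n + 1"
    have ac: "a \<in> {1..2 * n - 1}" "c \<in> {1..2 * n - 1}" "adjacent a n" "adjacent c n"
      "line.free_of c [a]" "line.free_of a [c]" "fold_letter n 1 = [a, c]"
      using 5(1) by (auto simp: a_def c_def adjacent_def line.free_of_def fold_letter_def of_nat_diff)
    have "[a, c, n, a, c] \<approx> [c] @ [a, n, a] @ [c]"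
      using line.eqv_move[OF ac(6), of "[]" "[n, a, c]"] line.eqv_sym by simp
    then have "T.cong (mon 0 [a, c, n, a, c]) (mon (0 + 0) ([c] @ [a] @ [c]))"
      by (intro T.step_cong line.step.braid[OF _ ac(3) line.eqv_refl]) (use ac nn in auto)
    also have "[c] @ [a] @ [c] \<approx> [a] @ [c, c] @ []"
      using line.eqv_move[OF ac(6), of "[]" "[c]"] line.eqv_sym by simp
    then have "T.cong (mon (0 + 0) ([c] @ [a] @ [c])) (mon (0 + 0 + 1) ([a] @ [c] @ []))"
      by (intro T.step_cong line.step.square[OF _ line.eqv_refl]) (use ac in auto)
    finally show ?thesis
      unfolding T.cong_def 5(2) subst_diff subst_mult subst_scal subst_gen subst_mon scal_delta mon_mult ac(7)
      by (simp add: fold_letter_def)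
  qed
qed

lemma \<Phi>_I:
  assumes "f \<in> D.I"
  shows "\<Phi> f \<in> T.I"
proof -
  let ?J = "{f \<in> carrier (free_alg {..<n}). \<Phi> f \<in> T.I}"
  have "ideal ?J (free_alg {..<n})"
  proof (rule ideal_free_algI)
    have "\<Phi> 0 \<in> T.I" unfolding subst_zero by (rule T.I_zero)
    then show "0 \<in> ?J" by simp
    show "f - g \<in> ?J" if "f \<in> ?J" "g \<in> ?J" for f g
      using that diff_closed[of f "{..<n}" g] T.I_diff by (simp add: subst_diff del: free_alg_simps)
    show "g * f \<in> ?J" "f * g \<in> ?J" if "f \<in> ?J" "g \<in> carrier (free_alg {..<n})" for f g
      using that mult_closed[of f _ g] mult_closed[of g _ f] T.I_mult[OF _ \<Phi>_closed[OF that(2)]]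
      by (simp_all add: subst_mult del: free_alg_simps)
  qed blast
  then have "D.I \<subseteq> ?J" by (rule D.I_minimal) (use \<Phi>_rel D.rels in blast)
  with assms show ?thesis by blast
qed

lemma \<Phi>_cong: "D.cong f g \<Longrightarrow> T.cong (\<Phi> f) (\<Phi> g)"
  unfolding D.cong_def T.cong_def subst_diff[symmetric] by (rule \<Phi>_I)

text \<open>Both words are reduced in type C until their folded images are irreducible. Transported
  to TL, the reductions preserve keys, and irreducible words with equal keys have equal exponents
  and are equivalent; unfolding the equivalence brings it back to type C.\<close>

lemma key_D_cong:
  assumes "set u \<subseteq> {..<n}" "set v \<subseteq> {..<n}"
    and "line.key k (fold_word n u) = line.key l (fold_word n v)"
  shows "D.cong (mon k u) (mon l v)"
proof -
  obtain s u' where u': "set u' \<subseteq> {..<n}" "D.cong (mon 0 u) (mon s u')"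
    "line.irreducible (fold_word n u')"
    using D_reduce[OF assms(1)] by blast
  obtain t v' where v': "set v' \<subseteq> {..<n}" "D.cong (mon 0 v) (mon t v')"
    "line.irreducible (fold_word n v')"
    using D_reduce[OF assms(2)] by blast
  have ku: "D.cong (mon k u) (mon (k + s) u')" and lv: "D.cong (mon l v) (mon (l + t) v')"
    using D.cong_mon[OF u'(2), of "[]" "[]" k] D.cong_mon[OF v'(2), of "[]" "[]" l] by simp_all
  have "line.key (k + s) (fold_word n u') = line.key (l + t) (fold_word n v')"
    using T.cong_key[OF \<Phi>_cong[OF ku, unfolded subst_mon]]
      T.cong_key[OF \<Phi>_cong[OF lv, unfolded subst_mon]] assms(3) by simp
  from line.key_irreducible[OF this u'(3) v'(3)]
  have "k + s = l + t" "u' \<approx> v'"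
    using eqv_if_fold_word_eqv[OF u'(1) v'(1)] by simp_all
  then have "D.cong (mon (k + s) u') (mon (l + t) v')" using D_eqv[OF _ u'(1)] by simp
  then show ?thesis using D.cong_trans[OF ku D.cong_trans[OF _ D.cong_sym[OF lv]]] by simp
qed

lemma \<Phi>_inj:
  assumes "f \<in> carrier (free_alg {..<n})" "\<Phi> f \<in> T.I"
  shows "f \<in> D.I"
proof (rule D.in_I_if_lin[OF assms(1)])
  show "lin (\<lambda>k w. of_bool (line.key k (fold_word n w) = t)) f = 0" for t
    using T.lin_key_I[OF assms(2), of t] by (simp add: lin_subst)
qed (rule key_D_cong)

text \<open>The induced map on cosets without a choice of representative: all members of the union
  are the same coset, by \<open>\<phi>_coset\<close>.\<close>

definition \<phi> :: "free set \<Rightarrow> free set"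
  where "\<phi> x = (\<Union>f\<in>x. T.coset (\<Phi> f))"

lemma \<phi>_coset: "\<phi> (D.coset f) = T.coset (\<Phi> f)"
proof -
  have "T.coset (\<Phi> g) = T.coset (\<Phi> f)" if g: "g \<in> D.coset f" for g
  proof -
    from g obtain h where "h \<in> D.I" "g = h + f" by (auto simp: coset_free_alg)
    then have "D.cong g f" by (simp add: D.cong_def)
    then show ?thesis using \<Phi>_cong T.coset_eq_iff by blast
  qed
  moreover have "f \<in> D.coset f" using D.I_zero by (force simp: coset_free_alg)
  ultimately show ?thesis unfolding \<phi>_def by blast
qed

section \<open>Mirror-symmetric words\<close>

abbreviation \<rho> :: "nat \<Rightarrow> nat"
  where "\<rho> i \<equiv> 2 * n - i"

lemma \<rho>_closed: "set w \<subseteq> {1..2 * n - 1} \<Longrightarrow> set (map \<rho> w) \<subseteq> {1..2 * n - 1}"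
proof
  fix x assume w: "set w \<subseteq> {1..2 * n - 1}" and "x \<in> set (map \<rho> w)"
  then obtain y where "y \<in> set w" "x = \<rho> y" by auto
  moreover from this w have "y \<in> {1..2 * n - 1}" by blast
  ultimately show "x \<in> {1..2 * n - 1}" by auto
qed

lemma eqv_map_\<rho>:
  assumes "u \<approx> v" "set u \<subseteq> {1..2 * n - 1}"
  shows "map \<rho> u \<approx> map \<rho> v"
  unfolding line.eqv_def
proof (intro allI impI)
  fix P assume P: "line.clique P"
  \<comment> \<open>Subtraction is truncated, so \<open>\<rho>\<close> reverses the line only on
    this range; outside it the preimage of a clique need not be a clique.\<close>
  let ?Q = "\<lambda>x. x \<in> {1..2 * n - 1} \<and> P (\<rho> x)"
  have "line.clique ?Q"
    unfolding line.clique_def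
  proof (intro allI impI)
    fix x y assume xy: "?Q x" "?Q y"
    then have "\<rho> x = \<rho> y \<or> adjacent (\<rho> x) (\<rho> y)" using P unfolding line.clique_def by blast
    then show "x = y \<or> adjacent x y" using xy by (auto simp: adjacent_def of_nat_diff)
  qed
  then have "filter ?Q u = filter ?Q v" using assms(1) unfolding line.eqv_def by blast
  moreover have "filter P (map \<rho> w) = map \<rho> (filter ?Q w)" if "set w \<subseteq> {1..2 * n - 1}" for w
    unfolding filter_map comp_def by (rule arg_cong[of _ _ "map \<rho>"], rule filter_cong) (use that in auto)
  ultimately show "filter P (map \<rho> u) = filter P (map \<rho> v)"
    using assms(2) line.eqv_set[OF assms(1)] by simp
qed

text \<open>A step on the mirror image is mirrored back to a step on w, since \<open>\<rho>\<close>
  preserves adjacency and is an involution on the letters.\<close>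

lemma irreducible_map_\<rho>:
  assumes "line.irreducible w" "set w \<subseteq> {1..2 * n - 1}"
  shows "line.irreducible (map \<rho> w)"
  unfolding line.irreducible_def
proof
  assume "\<exists>s v. line.step s (map \<rho> w) v"
  then obtain s v where "line.step s (map \<rho> w) v" by blast
  then have "\<exists>s v. line.step s (map \<rho> (map \<rho> w)) v"
  proof cases
    case (square a i d)
    from eqv_map_\<rho>[OF square(2) \<rho>_closed[OF assms(2)]]
    have "map \<rho> (map \<rho> w) \<approx> map \<rho> a @ [\<rho> i, \<rho> i] @ map \<rho> d"
      by (simp only: map_append list.map)
    from line.step.square[OF this line.eqv_refl] show ?thesis by blast
  next
    case (braid a i j d)
    have "i \<in> {1..2 * n - 1}" "j \<in> {1..2 * n - 1}"
      using line.eqv_set[OF braid(2)] \<rho>_closed[OF assms(2)] by auto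
    then have adj: "adjacent (\<rho> i) (\<rho> j)"
      using braid(3) by (auto simp: adjacent_def of_nat_diff)
    from eqv_map_\<rho>[OF braid(2) \<rho>_closed[OF assms(2)]]
    have "map \<rho> (map \<rho> w) \<approx> map \<rho> a @ [\<rho> i, \<rho> j, \<rho> i] @ map \<rho> d"
      by (simp only: map_append list.map)
    from line.step.braid[OF this adj line.eqv_refl] show ?thesis by blast
  qed
  moreover have "map \<rho> (map \<rho> w) = w"
    unfolding map_map
  proof (rule map_idI)
    fix x assume "x \<in> set w"
    then have "x \<in> {1..2 * n - 1}" using assms(2) by blast
    then show "(\<rho> \<circ> \<rho>) x = x" by auto
  qed
  ultimately show False using assms(1) by (simp add: line.irreducible_def)
qed

lemma symmetric_eqv_fold_word:
  assumes "set w \<subseteq> {1..2 * n - 1}" "map \<rho> w \<approx> w"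
  shows "\<exists>v. set v \<subseteq> {..<n} \<and> w \<approx> fold_word n v"
  using assms
proof (induction w rule: measure_induct_rule[of length])
  case (less w)
  show ?case
  proof (cases w)
    case Nil
    then show ?thesis by (intro exI[of _ "[]"]) simp
  next
    case (Cons i w')
    show ?thesis
    proof (cases "i = n")
      case True
      then have "n # map \<rho> w' \<approx> n # w'" using less.prems(2) Cons by simp
      then have "map \<rho> w' \<approx> w'" using line.eqv_cancel_left[of "[n]"] by simp
      then obtain v where v: "set v \<subseteq> {..<n}" "w' \<approx> fold_word n v"
        using less.IH[of w'] less.prems(1) Cons by auto
      have "fold_word n (0 # v) = n # fold_word n v" by (simp add: fold_letter_def[of n 0])
      then have "w \<approx> fold_word n (0 # v)" using line.eqv_Cons[OF v(2)] Cons True by simp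
      then show ?thesis using n v(1) by (intro exI[of _ "0 # v"]) simp
    next
      case False
      have i: "i \<in> {1..2 * n - 1}" "set w' \<subseteq> {1..2 * n - 1}" using less.prems(1) Cons by auto
      then have \<rho>i: "\<rho> i \<noteq> i" "\<rho> (\<rho> i) = i" "\<rho> i \<in> {1..2 * n - 1}" using False by auto
      \<comment> \<open>The mirror image of w begins with \<open>\<rho> i\<close> and is equivalent
        to w, so some \<open>\<rho> i\<close> can be moved to the front of w, past i.\<close>
      have "\<rho> i # map \<rho> w' \<approx> i # w'" using less.prems(2) Cons by simp
      then obtain A0 B where AB: "i # w' = A0 @ \<rho> i # B" "line.free_of (\<rho> i) A0" "map \<rho> w' \<approx> A0 @ B"
        by (rule line.eqv_ConsD)
      then obtain A where A: "A0 = i # A" "w' = A @ \<rho> i # B"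
        using \<rho>i(1) by (cases A0) auto
      have free: "line.free_of (\<rho> i) [i]" "line.free_of (\<rho> i) A"
        using AB(2) by (simp_all add: A(1) line.free_of_def)
      have sets: "set A \<subseteq> {1..2 * n - 1}" "set B \<subseteq> {1..2 * n - 1}" using i(2) A(2) by auto
      \<comment> \<open>The mirror image of the statement that \<open>\<rho> i\<close> commutes past
        A. It allows i to be moved to the front of \<open>map \<rho> w'\<close> and cancelled, which
        makes the remainder \<open>A @ B\<close> symmetric again.\<close>
      have "line.free_of i (map \<rho> A)"
        unfolding line.free_of_def
      proof
        fix x assume "x \<in> set (map \<rho> A)"
        then obtain y where y: "y \<in> set A" "x = \<rho> y" by auto
        then have "y \<noteq> \<rho> i \<and> \<not> adjacent (\<rho> i) y" using free(2) by (simp add: line.free_of_def)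
        moreover have "y \<in> {1..2 * n - 1}" using y(1) sets(1) by blast
        ultimately show "x \<noteq> i \<and> \<not> adjacent i x"
          using i(1) y(2) by (auto simp: adjacent_def of_nat_diff)
      qed
      then have "map \<rho> A @ i # map \<rho> B \<approx> i # map \<rho> A @ map \<rho> B"
        using line.eqv_move[of i "map \<rho> A" "[]" "map \<rho> B"] by simp
      then have "i # map \<rho> (A @ B) \<approx> map \<rho> w'"
        using line.eqv_sym by (simp add: A(2) \<rho>i(2))
      also have "map \<rho> w' \<approx> i # (A @ B)" using AB(3) by (simp add: A(1))
      finally have "map \<rho> (A @ B) \<approx> A @ B" using line.eqv_cancel_left[of "[i]"] by simp
      then obtain v where v: "set v \<subseteq> {..<n}" "A @ B \<approx> fold_word n v"
        using less.IH[of "A @ B"] sets Cons A(2) by auto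
      \<comment> \<open>The distance of i from the middle node n, which is also that of
        \<open>\<rho> i\<close>.\<close>
      define e where "e = (if i < n then n - i else i - n)"
      have e: "e < n" "e \<noteq> 0" using i(1) False by (auto simp: e_def)
      have ie: "fold_letter n e = [i, \<rho> i] \<or> fold_letter n e = [\<rho> i, i]"
        using i(1) False e(2) by (auto simp: fold_letter_def e_def)
      have swap: "[i, \<rho> i] \<approx> [\<rho> i, i]" using line.eqv_commute[OF free(1)] by simp
      have "w \<approx> [\<rho> i, i] @ A @ B"
        using line.eqv_move[OF AB(2), of "[]" B] by (simp add: A Cons)
      also have "[\<rho> i, i] @ A @ B \<approx> fold_letter n e @ fold_word n v"
        by (rule line.eqv_append[OF _ v(2)]) (use ie line.eqv_sym[OF swap] in auto)
      finally show ?thesis using v(1) e(1) by (intro exI[of _ "e # v"]) simp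
    qed
  qed
qed

section \<open>Invariant monomials and the image of the map\<close>

abbreviation A :: "(laurent, free set) module"
  where "A \<equiv> T.algebra"

lemma TL_A: "TL (2 * n - 1) = A"
  by (simp add: TL_def)

lemma DTL_D: "DTL n = D.algebra"
  by (simp add: DTL_def)

lemma tl_gen_coset: "tl_gen (2 * n - 1) i = T.coset (gen i)"
  by (simp add: tl_gen_def presented_gen_def)

lemma sigma_coset_mon:
  assumes "set w \<subseteq> {1..2 * n - 1}"
  shows "sigma n (T.coset (mon k w)) = T.coset (mon k (map \<rho> w))"
proof -
  have "sigma n \<in> alg_iso A A" using sigma_alg_iso[of n] unfolding TL_A .
  then have \<sigma>: "sigma n \<in> ring_hom A A"
    "\<And>c x. x \<in> carrier A \<Longrightarrow> sigma n (c \<odot>\<^bsub>A\<^esub> x) = c \<odot>\<^bsub>A\<^esub> sigma n x"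
    unfolding alg_iso_def alg_hom_def by blast+
  have one: "sigma n (T.coset 1) = T.coset 1"
    using ring_hom_one[OF \<sigma>(1)] by (simp only: presented_simps(2)[OF T.rels])
  show ?thesis
    using assms
  proof (induction w)
    case Nil
    show ?case
      by (simp only: list.map T.coset_mon_Nil \<sigma>(2)[OF T.coset_closed[OF one_closed]] one)
  next
    case (Cons i w)
    then have iw: "i \<in> {1..2 * n - 1}" "set w \<subseteq> {1..2 * n - 1}" by auto
    have \<rho>: "\<rho> i \<in> {1..2 * n - 1}" "set (map \<rho> w) \<subseteq> {1..2 * n - 1}"
      using \<rho>_closed[of "[i]"] \<rho>_closed[OF iw(2)] iw(1) by auto
    have "sigma n (T.coset (mon k (i # w))) = sigma n (T.coset (gen i)) \<otimes>\<^bsub>A\<^esub> sigma n (T.coset (mon k w))"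
      unfolding T.coset_mon_Cons[OF iw]
      by (rule ring_hom_mult[OF \<sigma>(1) T.coset_closed[OF gen_closed[OF iw(1)]]
          T.coset_closed[OF mon_closed[OF iw(2)]]])
    also have "\<dots> = T.coset (gen (\<rho> i)) \<otimes>\<^bsub>A\<^esub> T.coset (mon k (map \<rho> w))"
      using sigma_tl_gen[of n i] Cons.IH[OF iw(2)] by (simp only: tl_gen_coset)
    also have "\<dots> = T.coset (mon k (\<rho> i # map \<rho> w))"
      by (rule T.coset_mon_Cons[OF \<rho>, symmetric])
    finally show ?case by simp
  qed
qed

lemma TLM_mon:
  assumes "x \<in> TLM (2 * n - 1)"
  shows "\<exists>k w. set w \<subseteq> {1..2 * n - 1} \<and> x = T.coset (mon k w)"
proof -
  let ?M = "{T.coset (mon k w) | k w. set w \<subseteq> {1..2 * n - 1}}"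
  have M: "T.coset (mon k w) \<in> ?M" if "set w \<subseteq> {1..2 * n - 1}" for k w using that by blast
  note P = presented_simps[OF T.rels]
  have "submonoid ?M A"
  proof
    show "?M \<subseteq> carrier A" using T.coset_closed[OF mon_closed] by blast
    show "x \<otimes>\<^bsub>A\<^esub> y \<in> ?M" if x: "x \<in> ?M" and y: "y \<in> ?M" for x y
    proof -
      from x obtain k u where u: "set u \<subseteq> {1..2 * n - 1}" "x = T.coset (mon k u)" by blast
      from y obtain l v where v: "set v \<subseteq> {1..2 * n - 1}" "y = T.coset (mon l v)" by blast
      have "x \<otimes>\<^bsub>A\<^esub> y = T.coset (mon (k + l) (u @ v))"
        unfolding u(2) v(2) P(4)[OF mon_closed[OF u(1)] mon_closed[OF v(1)]] mon_mult ..
      moreover have "set (u @ v) \<subseteq> {1..2 * n - 1}" using u(1) v(1) by simp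
      ultimately show ?thesis by (simp only: M)
    qed
    show "\<one>\<^bsub>A\<^esub> \<in> ?M" unfolding P(2) one_mon by (rule M) simp
  qed
  moreover have "delta \<odot>\<^bsub>A\<^esub> \<one>\<^bsub>A\<^esub> \<in> ?M"
    unfolding P(2,6) scal_delta one_mon mon_mult by (rule M) simp
  moreover have "delta_inv \<odot>\<^bsub>A\<^esub> \<one>\<^bsub>A\<^esub> \<in> ?M"
    unfolding P(2,6) scal_delta_inv one_mon mon_mult by (rule M) simp
  moreover have "tl_gen (2 * n - 1) ` {1..2 * n - 1} \<subseteq> ?M"
  proof
    fix y assume "y \<in> tl_gen (2 * n - 1) ` {1..2 * n - 1}"
    then obtain i where i: "i \<in> {1..2 * n - 1}" "y = tl_gen (2 * n - 1) i" by blast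
    show "y \<in> ?M" unfolding i(2) tl_gen_coset gen_mon by (rule M) (use i(1) in simp)
  qed
  ultimately have "TLM (2 * n - 1) \<subseteq> ?M"
    unfolding TLM_def TL_A by (intro hull_minimal) simp_all
  with assms show ?thesis by blast
qed

lemma mon_TLM:
  assumes "set w \<subseteq> {1..2 * n - 1}"
  shows "T.coset (mon 0 w) \<in> TLM (2 * n - 1)"
  unfolding TLM_def hull_def
proof (intro InterI, elim CollectE conjE)
  fix M assume M: "submonoid M (TL (2 * n - 1))"
    and gens: "{delta \<odot>\<^bsub>TL (2 * n - 1)\<^esub> \<one>\<^bsub>TL (2 * n - 1)\<^esub>, delta_inv \<odot>\<^bsub>TL (2 * n - 1)\<^esub> \<one>\<^bsub>TL (2 * n - 1)\<^esub>} \<union>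
      tl_gen (2 * n - 1) ` {1..2 * n - 1} \<subseteq> M"
  show "T.coset (mon 0 w) \<in> M"
    using assms
  proof (induction w)
    case Nil
    show ?case
      using submonoid.one_closed[OF M] unfolding TL_A presented_simps(2)[OF T.rels] one_mon .
  next
    case (Cons i w)
    then have iw: "i \<in> {1..2 * n - 1}" "set w \<subseteq> {1..2 * n - 1}" by auto
    have "tl_gen (2 * n - 1) ` {1..2 * n - 1} \<subseteq> M" using gens by (rule le_supE)
    then have "T.coset (gen i) \<in> M" using imageI[OF iw(1)] unfolding tl_gen_coset by (rule subsetD)
    from submonoid.m_closed[OF M this Cons.IH[OF iw(2)]]
    show ?case unfolding TL_A T.coset_mon_Cons[OF iw] .
  qed
qed

abbreviation Z :: "free set set"
  where "Z \<equiv> {x \<in> TLM (2 * n - 1). sigma n x = x}"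

lemma fold_word_map_\<rho>:
  assumes "set v \<subseteq> {..<n}"
  shows "map \<rho> (fold_word n v) \<approx> fold_word n v"
  using assms
proof (induction v)
  case Nil
  show ?case by simp
next
  case (Cons e v)
  have "map \<rho> (fold_letter n e) \<approx> fold_letter n e"
  proof (cases "e = 0")
    case True
    then show ?thesis by (simp add: fold_letter_def)
  next
    case False
    have "line.free_of (n - e) [n + e]"
      using False Cons.prems by (auto simp: line.free_of_def adjacent_def of_nat_diff)
    then show ?thesis
      using line.eqv_commute[of "n - e" "[n + e]"] False Cons.prems by (simp add: fold_letter_def)
  qed
  then show ?case using line.eqv_append Cons by simp
qed

lemma fold_word_Z:
  assumes "set v \<subseteq> {..<n}"
  shows "T.coset (mon 0 (fold_word n v)) \<in> Z"
proof -
  have set: "set (fold_word n v) \<subseteq> {1..2 * n - 1}" using fold_word_set[OF assms] .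
  then have set': "set (map \<rho> (fold_word n v)) \<subseteq> {1..2 * n - 1}" by (rule \<rho>_closed)
  have "T.coset (mon 0 (map \<rho> (fold_word n v))) = T.coset (mon 0 (fold_word n v))"
    unfolding T.coset_eq_iff by (rule T.eqv_cong[OF fold_word_map_\<rho>[OF assms] set'])
  then show ?thesis using mon_TLM[OF set] sigma_coset_mon[OF set] by simp
qed

text \<open>Once x is written with an irreducible word w, invariance of x is an equality of cosets
  of two monomials, those of w and its mirror image. Both words are irreducible, so equal keys make
  them equivalent, and the symmetric word w folds.\<close>

lemma Z_fold_word:
  assumes "x \<in> Z"
  shows "\<exists>k v. set v \<subseteq> {..<n} \<and> x = T.coset (mon k (fold_word n v))"
proof -
  from assms obtain l u where u: "set u \<subseteq> {1..2 * n - 1}" "x = T.coset (mon l u)"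
    using TLM_mon by blast
  obtain s w where w: "line.nf u s w" using line.nf_exists by blast
  let ?k = "l + s"
  have set: "set w \<subseteq> {1..2 * n - 1}" using line.nf_set[OF w] u(1) by blast
  have x: "x = T.coset (mon ?k w)"
    unfolding u(2) T.coset_eq_iff by (rule T.nf_cong[OF w u(1)])
  then have "T.coset (mon ?k (map \<rho> w)) = T.coset (mon ?k w)"
    using assms sigma_coset_mon[OF set] by simp
  then have "line.key ?k (map \<rho> w) = line.key ?k w"
    unfolding T.coset_eq_iff by (rule T.cong_key)
  then have "map \<rho> w \<approx> w"
    using line.key_irreducible(2) irreducible_map_\<rho>[OF _ set] line.nf_irreducible[OF w] by blast
  from symmetric_eqv_fold_word[OF set this] obtain v
    where v: "set v \<subseteq> {..<n}" "w \<approx> fold_word n v" by blast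
  have "x = T.coset (mon ?k (fold_word n v))"
    unfolding x T.coset_eq_iff by (rule T.eqv_cong[OF v(2) set])
  with v(1) show ?thesis by blast
qed

lemma \<phi>_hom: "\<phi> \<in> alg_hom D.algebra A"
proof -
  note PD = presented_simps[OF D.rels] and PT = presented_simps[OF T.rels]
  have carrier: "\<exists>f\<in>carrier (free_alg {..<n}). x = D.coset f" if "x \<in> carrier D.algebra" for x
    using that unfolding PD(1) by blast
  have "\<phi> \<in> ring_hom D.algebra A"
  proof (rule ring_hom_memI)
    fix x assume "x \<in> carrier D.algebra"
    then obtain f where f: "f \<in> carrier (free_alg {..<n})" "x = D.coset f" using carrier by blast
    show "\<phi> x \<in> carrier A" unfolding f(2) \<phi>_coset by (rule T.coset_closed[OF \<Phi>_closed[OF f(1)]])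
    fix y assume "y \<in> carrier D.algebra"
    then obtain g where g: "g \<in> carrier (free_alg {..<n})" "y = D.coset g" using carrier by blast
    show "\<phi> (x \<otimes>\<^bsub>D.algebra\<^esub> y) = \<phi> x \<otimes>\<^bsub>A\<^esub> \<phi> y"
      unfolding f(2) g(2) PD(4)[OF f(1) g(1)] \<phi>_coset PT(4)[OF \<Phi>_closed[OF f(1)] \<Phi>_closed[OF g(1)]]
        subst_mult ..
    show "\<phi> (x \<oplus>\<^bsub>D.algebra\<^esub> y) = \<phi> x \<oplus>\<^bsub>A\<^esub> \<phi> y"
      unfolding f(2) g(2) PD(5)[OF f(1) g(1)] \<phi>_coset PT(5)[OF \<Phi>_closed[OF f(1)] \<Phi>_closed[OF g(1)]]
        subst_add ..
  next
    show "\<phi> \<one>\<^bsub>D.algebra\<^esub> = \<one>\<^bsub>A\<^esub>" unfolding PD(2) PT(2) \<phi>_coset subst_one ..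
  qed
  moreover have "\<phi> (c \<odot>\<^bsub>D.algebra\<^esub> x) = c \<odot>\<^bsub>A\<^esub> \<phi> x" if x: "x \<in> carrier D.algebra" for c x
  proof -
    obtain f where f: "x = D.coset f" using carrier[OF x] by blast
    show ?thesis unfolding f PD(6) PT(6) \<phi>_coset subst_scal ..
  qed
  ultimately show ?thesis by (simp add: alg_hom_def)
qed

text \<open>Folded words are invariant monomials, and scalars and differences of them give every
  element of the image, so the image lies in each subalgebra containing \<open>Z\<close>. Conversely
  the image is a subalgebra, and it contains \<open>Z\<close> by \<open>Z_fold_word\<close>.\<close>

lemma \<phi>_image: "\<phi> ` carrier D.algebra = (\<lambda>B. subalg B A) hull Z"
proof
  note PD = presented_simps[OF D.rels] and PT = presented_simps[OF T.rels]
  interpret A: ring A by (rule ring_presented[OF T.rels])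
  have image: "\<phi> ` carrier D.algebra = (\<lambda>f. T.coset (\<Phi> f)) ` carrier (free_alg {..<n})"
    unfolding PD(1) image_image \<phi>_coset ..
  show "\<phi> ` carrier D.algebra \<subseteq> (\<lambda>B. subalg B A) hull Z"
  proof
    fix x assume "x \<in> \<phi> ` carrier D.algebra"
    then obtain f where f: "f \<in> carrier (free_alg {..<n})" "x = T.coset (\<Phi> f)"
      unfolding image by blast
    have "T.coset (\<Phi> f) \<in> B" if B: "subalg B A" "Z \<subseteq> B" for B
    proof -
      have smult: "c \<odot>\<^bsub>A\<^esub> y \<in> B" if "y \<in> B" for c y
        using B(1) that by (simp add: subalg_def)
      have subring: "subring B A" using B(1) by (simp add: subalg_def)
      from f(1) show ?thesis
      proof (induction f rule: free_alg_induct)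
        case zero
        show ?case unfolding subst_zero PT(3)[symmetric] by (rule subringE(2)[OF subring])
      next
        case (mon k w)
        have "T.coset (mon k (fold_word n w)) =
            Poly_Mapping.single k 1 \<odot>\<^bsub>A\<^esub> T.coset (mon 0 (fold_word n w))"
          unfolding PT(6) scal_mon mon_mult by simp
        then show ?case unfolding subst_mon using smult fold_word_Z[OF mon] B(2) by auto
      next
        case (diff f g)
        show ?case
          unfolding subst_diff T.coset_diff[OF \<Phi>_closed[OF diff(1)] \<Phi>_closed[OF diff(2)]]
          by (rule subringE(7)[OF subring diff.IH(1) smult[OF diff.IH(2)]])
      qed
    qed
    then show "x \<in> (\<lambda>B. subalg B A) hull Z" unfolding hull_def f(2) by blast
  qed
  show "(\<lambda>B. subalg B A) hull Z \<subseteq> \<phi> ` carrier D.algebra"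
  proof (rule hull_minimal)
    show "Z \<subseteq> \<phi> ` carrier D.algebra"
    proof
      fix x assume "x \<in> Z"
      then obtain k v where v: "set v \<subseteq> {..<n}" "x = T.coset (\<Phi> (mon k v))"
        using Z_fold_word unfolding subst_mon by blast
      then show "x \<in> \<phi> ` carrier D.algebra" unfolding image using mon_closed[OF v(1)] by blast
    qed
    let ?F = "carrier (free_alg {..<n})"
    have I: "T.coset (\<Phi> f) \<in> \<phi> ` carrier D.algebra" if "f \<in> ?F" for f
      unfolding image using that by blast
    have E: "\<exists>f\<in>?F. x = T.coset (\<Phi> f)" if "x \<in> \<phi> ` carrier D.algebra" for x
      using that unfolding image by blast
    have "subring (\<phi> ` carrier D.algebra) A"
    proof (rule A.subringI)
      show "\<phi> ` carrier D.algebra \<subseteq> carrier A"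
        unfolding image using T.coset_closed[OF \<Phi>_closed] by blast
      show "\<one>\<^bsub>A\<^esub> \<in> \<phi> ` carrier D.algebra"
        using I[OF one_closed] unfolding PT(2) subst_one .
    next
      fix x assume "x \<in> \<phi> ` carrier D.algebra"
      then obtain f where f: "f \<in> ?F" "x = T.coset (\<Phi> f)" using E by blast
      have f': "0 - f \<in> ?F" by (rule diff_closed[OF _ f(1)]) simp
      have "T.coset (\<Phi> (0 - f)) \<oplus>\<^bsub>A\<^esub> x = \<zero>\<^bsub>A\<^esub>"
        unfolding f(2) PT(5)[OF \<Phi>_closed[OF f'] \<Phi>_closed[OF f(1)]] PT(3) subst_add[symmetric]
        by (simp add: subst_zero)
      then have "\<ominus>\<^bsub>A\<^esub> x = T.coset (\<Phi> (0 - f))"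
        by (rule A.minus_equality) (simp_all only: f(2) T.coset_closed \<Phi>_closed f f')
      then show "\<ominus>\<^bsub>A\<^esub> x \<in> \<phi> ` carrier D.algebra" using I[OF f'] by simp
    next
      fix x y assume "x \<in> \<phi> ` carrier D.algebra" "y \<in> \<phi> ` carrier D.algebra"
      then obtain f g where fg: "f \<in> ?F" "x = T.coset (\<Phi> f)" "g \<in> ?F" "y = T.coset (\<Phi> g)"
        using E by metis
      note cl = \<Phi>_closed[OF fg(1)] \<Phi>_closed[OF fg(3)]
      show "x \<otimes>\<^bsub>A\<^esub> y \<in> \<phi> ` carrier D.algebra"
        unfolding fg(2,4) PT(4)[OF cl] subst_mult[symmetric] by (rule I[OF mult_closed[OF fg(1,3)]])
      show "x \<oplus>\<^bsub>A\<^esub> y \<in> \<phi> ` carrier D.algebra"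
        unfolding fg(2,4) PT(5)[OF cl] subst_add[symmetric] by (rule I[OF add_closed[OF fg(1,3)]])
    qed
    moreover have "c \<odot>\<^bsub>A\<^esub> x \<in> \<phi> ` carrier D.algebra" if x: "x \<in> \<phi> ` carrier D.algebra" for c x
    proof -
      obtain f where f: "f \<in> ?F" "x = T.coset (\<Phi> f)" using E[OF x] by blast
      show ?thesis unfolding f(2) PT(6) subst_scal[symmetric] by (rule I[OF scal_closed[OF f(1)]])
    qed
    ultimately show "subalg (\<phi> ` carrier D.algebra) A" by (simp add: subalg_def)
  qed
qed

lemma \<phi>_inj: "inj_on \<phi> (carrier D.algebra)"
proof (rule inj_onI)
  fix x y assume x: "x \<in> carrier D.algebra" and y: "y \<in> carrier D.algebra" and eq: "\<phi> x = \<phi> y"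
  from x obtain f where f: "f \<in> carrier (free_alg {..<n})" "x = D.coset f"
    unfolding presented_simps(1)[OF D.rels] by blast
  from y obtain g where g: "g \<in> carrier (free_alg {..<n})" "y = D.coset g"
    unfolding presented_simps(1)[OF D.rels] by blast
  have "\<Phi> (f - g) \<in> T.I"
    using eq unfolding f(2) g(2) \<phi>_coset T.coset_eq_iff T.cong_def subst_diff .
  from \<Phi>_inj[OF diff_closed[OF f(1) g(1)] this] show "x = y"
    unfolding f(2) g(2) D.coset_eq_iff D.cong_def .
qed

lemma STL_A: "STL n = A\<lparr>carrier := \<phi> ` carrier D.algebra\<rparr>"
  unfolding STL_def TL_A \<phi>_image ..

lemma \<phi>_iso: "\<phi> \<in> alg_iso (DTL n) (STL n)"
proof -
  have hom: "\<phi> \<in> ring_hom D.algebra A"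
    and smult: "\<forall>c. \<forall>x \<in> carrier D.algebra. \<phi> (c \<odot>\<^bsub>D.algebra\<^esub> x) = c \<odot>\<^bsub>A\<^esub> \<phi> x"
    using \<phi>_hom unfolding alg_hom_def by blast+
  have S: "carrier (STL n) = \<phi> ` carrier D.algebra" "monoid.mult (STL n) = monoid.mult A" "add (STL n) = add A"
    "one (STL n) = one A" "smult (STL n) = smult A"
    unfolding STL_A by simp_all
  have "\<phi> \<in> ring_hom D.algebra (STL n)"
    by (rule ring_hom_memI; unfold S)
      (rule imageI ring_hom_mult[OF hom] ring_hom_add[OF hom] ring_hom_one[OF hom]; assumption?)+
  moreover have "bij_betw \<phi> (carrier D.algebra) (carrier (STL n))"
    unfolding S using \<phi>_inj by (rule inj_on_imp_bij_betw)
  ultimately show ?thesis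
    using smult unfolding alg_iso_def alg_hom_def DTL_D S by blast
qed

lemma \<phi>_gen:
  assumes "i < n"
  shows "\<phi> (dtl_gen n i) = phi_gen n i"
proof -
  have "\<phi> (dtl_gen n i) = T.coset (mon 0 (fold_letter n i))"
    by (simp only: dtl_gen_def presented_gen_def \<phi>_coset subst_gen)
  also have "\<dots> = phi_gen n i"
  proof (cases "i = 0")
    case True
    then show ?thesis by (simp only: phi_gen_def tl_gen_coset fold_letter_def gen_mon simp_thms if_True)
  next
    case False
    then have i: "n - i \<in> {1..2 * n - 1}" "n + i \<in> {1..2 * n - 1}" using assms by auto
    have "T.coset (gen (n - i)) \<otimes>\<^bsub>A\<^esub> T.coset (gen (n + i)) = T.coset (gen (n - i) * gen (n + i))"
      by (rule presented_simps(4)[OF T.rels gen_closed[OF i(1)] gen_closed[OF i(2)]])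
    also have "\<dots> = T.coset (mon 0 [n - i, n + i])"
      by (simp only: gen_mon mon_mult append.simps add_0)
    finally show ?thesis using False by (simp only: phi_gen_def tl_gen_coset TL_A fold_letter_def if_False)
  qed
  finally show ?thesis .
qed

end

theorem theorem6p3:
  fixes n :: nat
  assumes "n \<ge> 1"
  shows "\<exists>\<phi> \<in> alg_iso (DTL n) (STL n).
    (\<forall>i < n. \<phi> (dtl_gen n i) = phi_gen n i) \<and>
    (\<forall>\<psi> \<in> alg_hom (DTL n) (STL n). (\<forall>i < n. \<psi> (dtl_gen n i) = phi_gen n i) \<longrightarrow>
      (\<forall>x \<in> carrier (DTL n). \<psi> x = \<phi> x))"
proof -
  interpret dtl n by (rule dtl.intro[OF assms])
  have hom: "\<phi> \<in> alg_hom (DTL n) (STL n)" using \<phi>_iso by (simp only: alg_iso_def mem_Collect_eq)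
  have "\<psi> x = \<phi> x"
    if \<psi>: "\<psi> \<in> alg_hom (DTL n) (STL n)" "\<forall>i < n. \<psi> (dtl_gen n i) = phi_gen n i"
      and x: "x \<in> carrier (DTL n)" for \<psi> x
  proof (rule D.alg_hom_unique[OF \<psi>(1)[unfolded DTL_D] hom[unfolded DTL_D] _ x[unfolded DTL_D]])
    fix i assume "i \<in> {..<n}"
    then have "i < n" by simp
    then have "\<psi> (dtl_gen n i) = \<phi> (dtl_gen n i)" using \<psi>(2) \<phi>_gen by simp
    then show "\<psi> (presented_gen {..<n} (dtl_rels n) i) = \<phi> (presented_gen {..<n} (dtl_rels n) i)"
      by (simp only: dtl_gen_def)
  qed
  then show ?thesis using \<phi>_gen by (intro bexI[OF _ \<phi>_iso] conjI allI impI ballI) simp_all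
qed

end
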